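(* Let $\rho^{\mathrm{ab}}_{\mathbf q}$ be the abelian complexity function of the $4$-bonacci word $\mathbf q$. Then: (1) $\{\rho^{\mathrm{ab}}_{\mathbf q}(n): n\in\mathbb N\}=\{4\}\cup\{6,7,\ldots,16\}$; (2) $\rho^{\mathrm{ab}}_{\mathbf q}(n)=4$ if and only if $\langle n\rangle_Q$ is a prefix of $100010001000\cdots$; (3) $\rho^{\mathrm{ab}}_{\mathbf q}(n)=6$ if and only if $n\in\{3,6,12\}$; (4) for every $c\in\{7,\ldots,16\}$ there exist infinitely many $n\in\mathbb N$ with $\rho^{\mathrm{ab}}_{\mathbf q}(n)=c$.
   Context: The $4$-bonacci word $\mathbf q$ is the fixed point of the substitution $0\mapsto01,\ 1\mapsto02,\ 2\mapsto03,\ 3\mapsto0$ over $\{0,1,2,3\}$. Its abelian complexity $\rho^{\mathrm{ab}}_{\mathbf q}(n)$ is the number of distinct Parikh vectors $(|w|_0,|w|_1,|w|_2,|w|_3)$ over all factors $w$ of $\mathbf q$ of length $n$. Tetranacci numbers: $Q_0=Q_1=Q_2=0$, $Q_3=1$, $Q_j=Q_{j-1}+Q_{j-2}+Q_{j-3}+Q_{j-4}$. The $4$-bonacci representation $\langle n\rangle_Q=d_k\cdots d_0$ of $n\in\mathbb N$ is the digit string with $d_j\in\{0,1\}$, $n=\sum_jd_jQ_{j+4}$, obtained by the greedy algorithm, written without leading zeros. *)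

theory Defs
  imports "HOL-Library.Stream"
begin

definition subst4 :: "nat \<Rightarrow> nat list" where
  "subst4 a = (if a = 0 then [0, 1] else if a = 1 then [0, 2] else if a = 2 then [0, 3] else [0])"

text \<open>Letters other than 0, 1, 2, 3 do not occur in any image of \<^const>\<open>subst4\<close>, so every
  fixed point is automatically a word over \<open>{0, 1, 2, 3}\<close>.\<close>

definition subst4_fixed_point :: "nat stream \<Rightarrow> bool" where
  "subst4_fixed_point w \<longleftrightarrow> flat (smap subst4 w) = w"

definition fourbonacci_word :: "nat stream" where
  "fourbonacci_word = (THE w. subst4_fixed_point w)"

definition factors_of_length :: "'a stream \<Rightarrow> nat \<Rightarrow> 'a list set" where
  "factors_of_length w n = {stake n (sdrop i w) | i. True}"

definition parikh :: "nat list \<Rightarrow> nat \<times> nat \<times> nat \<times> nat" where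
  "parikh u = (count_list u 0, count_list u 1, count_list u 2, count_list u 3)"

definition abelian_complexity :: "nat stream \<Rightarrow> nat \<Rightarrow> nat" where
  "abelian_complexity w n = card (parikh ` factors_of_length w n)"

fun tetranacci :: "nat \<Rightarrow> nat" where
  "tetranacci 0 = 0"
| "tetranacci (Suc 0) = 0"
| "tetranacci (Suc (Suc 0)) = 0"
| "tetranacci (Suc (Suc (Suc 0))) = 1"
| "tetranacci (Suc (Suc (Suc (Suc j)))) =
     tetranacci (Suc (Suc (Suc j))) + tetranacci (Suc (Suc j)) + tetranacci (Suc j) + tetranacci j"

text \<open>Digit strings are lists with the most significant digit first; \<open>greedy_digits k n\<close> produces
  the digits at positions \<open>k - 1, \<dots>, 0\<close>.\<close>

fun greedy_digits :: "nat \<Rightarrow> nat \<Rightarrow> nat list" where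
  "greedy_digits 0 n = []"
| "greedy_digits (Suc k) n =
     (if tetranacci (k + 4) \<le> n then 1 # greedy_digits k (n - tetranacci (k + 4))
      else 0 # greedy_digits k n)"

text \<open>Starting at the least \<open>k\<close> with \<open>n < tetranacci (k + 4)\<close> yields the expansion without
  leading zeros (and the empty string for \<open>0\<close>).\<close>

definition fourbonacci_rep :: "nat \<Rightarrow> nat list" where
  "fourbonacci_rep n = greedy_digits (LEAST k. n < tetranacci (k + 4)) n"


subsection \<open>Existence and uniqueness of the fixed point\<close>

definition subst4_word :: "nat list \<Rightarrow> nat list" where
  "subst4_word u = concat (map subst4 u)"

lemma subst4_word_append: "subst4_word (u @ v) = subst4_word u @ subst4_word v"
  by (simp add: subst4_word_def)

lemma subst4_nonempty [simp]: "subst4 a \<noteq> []"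
  by (simp add: subst4_def)

lemma flat_smap_subst4_shift:
  "flat (smap subst4 (u @- v)) = subst4_word u @- flat (smap subst4 v)"
proof (induction u)
  case Nil
  show ?case by (simp add: subst4_word_def)
next
  case (Cons a u)
  then show ?case by (subst flat_unfold) (simp_all add: subst4_word_def)
qed

lemma stream_nth_eqI:
  fixes v w :: "'a stream"
  assumes "\<And>i. v !! i = w !! i"
  shows "v = w"
  using assms by (metis ext stream_smap_nats)

definition subst4_iter :: "nat \<Rightarrow> nat list" where
  "subst4_iter k = (subst4_word ^^ k) [0]"

lemma subst4_iter_Suc: "subst4_iter (Suc k) = subst4_word (subst4_iter k)"
  by (simp add: subst4_iter_def)

lemma subst4_iter_extend: "\<exists>r. r \<noteq> [] \<and> subst4_iter (Suc k) = subst4_iter k @ r"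
proof (induction k)
  case 0
  show ?case by (simp add: subst4_iter_def subst4_word_def subst4_def)
next
  case (Suc k)
  then obtain r where r: "r \<noteq> []" "subst4_iter (Suc k) = subst4_iter k @ r" by blast
  have "subst4_iter (Suc (Suc k)) = subst4_word (subst4_iter k) @ subst4_word r"
    by (metis subst4_iter_Suc r(2) subst4_word_append)
  moreover have "subst4_word r \<noteq> []"
    using r(1) by (cases r) (simp_all add: subst4_word_def)
  ultimately show ?case by (metis subst4_iter_Suc)
qed

lemma length_subst4_iter: "k < length (subst4_iter k)"
proof (induction k)
  case 0
  show ?case by (simp add: subst4_iter_def)
next
  case (Suc k)
  obtain r where "r \<noteq> []" "subst4_iter (Suc k) = subst4_iter k @ r"
    using subst4_iter_extend by blast
  with Suc show ?case by (cases r) auto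
qed

lemma subst4_iter_nth:
  assumes "i < length (subst4_iter k)" "k \<le> m"
  shows "i < length (subst4_iter m) \<and> subst4_iter m ! i = subst4_iter k ! i"
  using assms(2)
proof (induction m rule: dec_induct)
  case base
  show ?case using assms(1) by simp
next
  case (step m)
  obtain r where "subst4_iter (Suc m) = subst4_iter m @ r"
    using subst4_iter_extend by blast
  with step show ?case by (simp add: nth_append)
qed

definition subst4_limit :: "nat stream" where
  "subst4_limit = smap (\<lambda>i. subst4_iter i ! i) nats"

lemma subst4_limit_nth: "i < length (subst4_iter k) \<Longrightarrow> subst4_limit !! i = subst4_iter k ! i"
  using subst4_iter_nth[of i k "max i k"] subst4_iter_nth[of i i "max i k"] length_subst4_iter[of i]
  by (simp add: subst4_limit_def)

lemma subst4_limit_shift: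
  "subst4_limit = subst4_iter k @- sdrop (length (subst4_iter k)) subst4_limit"
proof -
  have "stake (length (subst4_iter k)) subst4_limit = subst4_iter k"
    by (rule nth_equalityI) (simp_all add: subst4_limit_nth)
  then show ?thesis by (metis stake_sdrop)
qed

lemma subst4_fixed_point_limit: "subst4_fixed_point subst4_limit"
  unfolding subst4_fixed_point_def
proof (rule stream_nth_eqI)
  fix i
  have "flat (smap subst4 subst4_limit) =
      subst4_iter (Suc i) @- flat (smap subst4 (sdrop (length (subst4_iter i)) subst4_limit))"
    by (subst subst4_limit_shift[of i]) (simp only: flat_smap_subst4_shift subst4_iter_Suc)
  moreover have "i < length (subst4_iter (Suc i))"
    using length_subst4_iter[of "Suc i"] by simp
  ultimately show "flat (smap subst4 subst4_limit) !! i = subst4_limit !! i"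
    by (simp add: subst4_limit_nth)
qed

lemma subst4_fixed_point_unique:
  assumes "subst4_fixed_point w"
  shows "w = subst4_limit"
proof -
  have fix_w: "flat (smap subst4 w) = w"
    using assms by (simp add: subst4_fixed_point_def)
  have prefix_w: "\<exists>v. w = subst4_iter k @- v" for k
  proof (induction k)
    case 0
    have "shd w = hd (subst4 (shd w))"
      by (subst fix_w[symmetric]) simp
    then have "shd w = 0" by (simp add: subst4_def split: if_splits)
    then have "w = [0] @- stl w" by (metis shift.simps stream.collapse)
    then show ?case by (auto simp: subst4_iter_def)
  next
    case (Suc k)
    then obtain v where "w = subst4_iter k @- v" by blast
    then have "w = subst4_iter (Suc k) @- flat (smap subst4 v)"
      by (metis fix_w flat_smap_subst4_shift subst4_iter_Suc)
    then show ?case by blast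
  qed
  show ?thesis
  proof (rule stream_nth_eqI)
    fix i
    show "w !! i = subst4_limit !! i"
      using prefix_w[of i] length_subst4_iter[of i] by (auto simp: subst4_limit_nth)
  qed
qed

lemma subst4_fixed_point_ex1: "\<exists>!w. subst4_fixed_point w"
  using subst4_fixed_point_limit subst4_fixed_point_unique by blast

lemma fourbonacci_word_fixed_point: "subst4_fixed_point fourbonacci_word"
  unfolding fourbonacci_word_def by (rule theI'[OF subst4_fixed_point_ex1])


subsection \<open>Correctness of the representation\<close>

fun rep_value :: "nat list \<Rightarrow> nat" where
  "rep_value [] = 0"
| "rep_value (d # ds) = d * tetranacci (length ds + 4) + rep_value ds"

lemma tetranacci_growth:
  "tetranacci (k + 4) < tetranacci (k + 5) \<and> tetranacci (k + 5) \<le> 2 * tetranacci (k + 4)"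
proof (induction k rule: less_induct)
  case (less k)
  show ?case
  proof (cases k)
    case 0
    then show ?thesis by (simp add: eval_nat_numeral)
  next
    case (Suc m)
    then have "tetranacci (m + 4) < tetranacci (m + 5)" using less by simp
    then show ?thesis using Suc by (auto simp: eval_nat_numeral)
  qed
qed

lemma less_tetranacci: "n < tetranacci (n + 4)"
proof (induction n)
  case 0
  show ?case by (simp add: eval_nat_numeral)
next
  case (Suc n)
  have "tetranacci (Suc n + 4) = tetranacci (n + 5)" by (simp add: eval_nat_numeral)
  with Suc tetranacci_growth[of n] show ?case by linarith
qed

lemma length_greedy_digits [simp]: "length (greedy_digits k n) = k"
  by (induction k arbitrary: n) auto

lemma rep_value_greedy_digits: "n < tetranacci (k + 4) \<Longrightarrow> rep_value (greedy_digits k n) = n"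
proof (induction k arbitrary: n)
  case 0
  then show ?case by (simp add: eval_nat_numeral)
next
  case (Suc k)
  have "n < 2 * tetranacci (k + 4)"
    using Suc.prems tetranacci_growth[of k] by (simp add: eval_nat_numeral)
  then show ?case using Suc.IH by auto
qed

lemma rep_value_fourbonacci_rep: "rep_value (fourbonacci_rep n) = n"
  unfolding fourbonacci_rep_def
  by (rule rep_value_greedy_digits) (rule LeastI, rule less_tetranacci)

lemma fourbonacci_rep_no_leading_zero: "n \<ge> 1 \<Longrightarrow> \<exists>ds. fourbonacci_rep n = 1 # ds"
proof -
  assume n: "n \<ge> 1"
  let ?k = "LEAST k. n < tetranacci (k + 4)"
  have "n < tetranacci (?k + 4)" by (rule LeastI) (rule less_tetranacci)
  moreover have "\<not> n < tetranacci (0 + 4)" using n by (simp add: eval_nat_numeral)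
  ultimately have "?k \<noteq> 0" by metis
  then obtain m where m: "?k = Suc m" by (cases ?k) auto
  then have "\<not> n < tetranacci (m + 4)" using not_less_Least[of m] by (metis lessI)
  then show ?thesis by (simp add: fourbonacci_rep_def m)
qed

end

theory Submission
  imports Defs "HOL-Library.Product_Plus"
begin

text \<open>
  Every position \<open>i\<close> of the word is \<open>|\<sigma>(u)| + d\<close> with \<open>u\<close> a shorter prefix and \<open>d \<in> {0, 1}\<close>, so the
  Parikh vector of the prefix of length \<open>i\<close> arises from that of \<open>u\<close> by the incidence matrix and the
  digit \<open>d\<close>. For a fixed length \<open>n\<close> the abelian complexity counts the deviations \<open>P k - P i - P n\<close> with
  \<open>k = i + n\<close>, where \<open>P\<close> is the prefix Parikh vector. If deviations with \<open>k \<noteq> i + n\<close> are admitted as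
  well, those of \<open>n\<close> are computed digit by digit from those of its predecessor. Only finitely
  many deviations can contribute, because a deviation whose total length is too far from \<open>0\<close> never
  returns. This gives a finite automaton that reads the digits of \<open>n\<close> and whose states are sets of
  deviations, each paired with the letters at \<open>i\<close> and \<open>k\<close>.

  That automaton is large, but the claims need little of it: 111 supersets of its states, closed under
  the transitions and with at most 16 deviations of length \<open>0\<close> each, prove the upper bound, and 32
  subsets prove \<open>\<rho> n \<ge> 7\<close> away from the exceptional orbit. The orbit itself and finitely many runs
  starting from its cycle are followed exactly.
\<close>

subsection \<open>Desubstitution of prefixes\<close>

type_synonym vec = "int \<times> int \<times> int \<times> int"

definition letter :: "nat \<Rightarrow> nat" where
  "letter i = fourbonacci_word !! i"

definition img :: "nat \<Rightarrow> nat" where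
  "img i = length (subst4_word (stake i fourbonacci_word))"

lemma fourbonacci_word_split:
  "fourbonacci_word = subst4_word (stake i fourbonacci_word) @-
     flat (smap subst4 (sdrop i fourbonacci_word))"
  using fourbonacci_word_fixed_point
  by (metis flat_smap_subst4_shift stake_sdrop subst4_fixed_point_def)

lemma stake_img: "stake (img i) fourbonacci_word = subst4_word (stake i fourbonacci_word)"
  by (subst (1) fourbonacci_word_split[of i]) (simp add: img_def stake_shift)

lemma sdrop_img:
  "sdrop (img i) fourbonacci_word =
     subst4 (letter i) @- flat (smap subst4 (sdrop (Suc i) fourbonacci_word))"
proof -
  have "sdrop (img i) fourbonacci_word = flat (smap subst4 (sdrop i fourbonacci_word))"
    by (subst (1) fourbonacci_word_split[of i]) (simp add: img_def sdrop_shift)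
  also have "\<dots> = subst4 (letter i) @- flat (smap subst4 (sdrop (Suc i) fourbonacci_word))"
    by (subst flat_unfold) (simp_all add: letter_def)
  finally show ?thesis .
qed

lemma img_0 [simp]: "img 0 = 0"
  by (simp add: img_def subst4_word_def)

lemma img_Suc: "img (Suc i) = img i + (if letter i < 3 then 2 else 1)"
  unfolding img_def stake_Suc by (simp add: subst4_word_append) (simp add: subst4_word_def subst4_def letter_def)

text \<open>The word starts with 0, whose image has two letters, and every later letter contributes
  at least one. Hence passing from a position to its parent terminates.\<close>

lemma less_img: "i \<ge> 1 \<Longrightarrow> i < img i"
proof (induction i)
  case (Suc i)
  have "letter 0 < 3"
    using arg_cong[OF sdrop_img[of 0], of shd] by (simp add: subst4_def letter_def sdrop_simps split: if_splits)
  with Suc show ?case by (cases i) (auto simp: img_Suc)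
qed simp

lemma letter_img: "letter (img i) = 0"
  using arg_cong[OF sdrop_img[of i], of shd] by (simp add: subst4_def letter_def sdrop_simps split: if_splits)

lemma letter_Suc_img: "letter i < 3 \<Longrightarrow> letter (Suc (img i)) = Suc (letter i)"
  using arg_cong[OF sdrop_img[of i], of "\<lambda>s. s !! 1"]
  by (auto simp: subst4_def sdrop_snth letter_def split: if_splits)

text \<open>Position \<open>j\<close> lies at offset \<open>d\<close> in the image of the letter at
  \<open>i\<close>. On numbers the same relation appends the digit \<open>d\<close>: by
  \<open>letter_child\<close> the letter counts trailing ones, so \<open>letter i < 3\<close>
  forbids four consecutive ones.\<close>

definition child :: "nat \<Rightarrow> nat \<Rightarrow> nat \<Rightarrow> bool" where
  "child i d j \<longleftrightarrow> j = img i + d \<and> (d = 0 \<or> d = 1 \<and> letter i < 3)"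

text \<open>The images of the letters tile the word; the induction moves to the next offset or to
  the next image.\<close>

lemma child_exists: "\<exists>i d. child i d n"
proof (induction n)
  case 0
  show ?case by (rule exI[of _ 0]) (simp add: child_def)
next
  case (Suc n)
  then obtain i d where *: "child i d n" by blast
  show ?case
  proof (cases "d = 0 \<and> letter i < 3")
    case True
    with * have "child i 1 (Suc n)" by (simp add: child_def)
    then show ?thesis by blast
  next
    case False
    with * have "child (Suc i) 0 (Suc n)" by (auto simp: child_def img_Suc)
    then show ?thesis by blast
  qed
qed

lemma child_less: "child i d n \<Longrightarrow> n \<ge> 1 \<Longrightarrow> i < n"
  using less_img[of i] by (cases "i = 0") (auto simp: child_def)

lemma child_le: "child i d n \<Longrightarrow> i \<le> n"
  using less_img[of i] by (cases "i = 0") (auto simp: child_def)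

lemma child_zero: "child 0 0 0"
  by (simp add: child_def)

lemma letter_child: "child i d j \<Longrightarrow> letter j = (if d = 0 then 0 else Suc (letter i))"
  by (auto simp: child_def letter_img letter_Suc_img)

lemma child_digit: "child i d j \<Longrightarrow> d = 0 \<or> d = 1 \<and> letter i < 3"
  by (auto simp: child_def)

lemma letter_le_3: "letter n \<le> 3"
proof -
  obtain i d where "child i d n" using child_exists by blast
  with letter_child[OF this] child_digit[OF this] show ?thesis by auto
qed

section \<open>Parikh vectors of prefixes and the incidence matrix\<close>

fun len :: "vec \<Rightarrow> int" where
  "len (x, y, z, w) = x + y + z + w"

text \<open>The incidence matrix of the substitution, followed by adding \<open>t\<close> letters 0:
  offset 1 in an image splits off its first letter, which is always 0.\<close>

fun step :: "int \<Rightarrow> vec \<Rightarrow> vec" where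
  "step t (x, y, z, w) = (x + y + z + w + t, x, y, z)"

definition vec_of :: "nat list \<Rightarrow> vec" where
  "vec_of u = (int (count_list u 0), int (count_list u 1), int (count_list u 2), int (count_list u 3))"

lemma vec_of_Nil [simp]: "vec_of [] = 0"
  by (simp add: vec_of_def zero_prod_def)

lemma vec_of_append: "vec_of (u @ v) = vec_of u + vec_of v"
  by (simp add: vec_of_def)

lemma len_add [simp]: "len (u + v) = len u + len v"
  by (cases u; cases v) simp

lemma len_diff [simp]: "len (u - v) = len u - len v"
  by (cases u; cases v) simp

lemma len_zero [simp]: "len 0 = 0"
  by (simp add: zero_prod_def)

lemma step_add: "step (t + t') (u + v) = step t u + step t' v"
  by (cases u; cases v) simp

lemma step_diff: "step (t - t') (u - v) = step t u - step t' v"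
  by (cases u; cases v) simp

lemma step_zero [simp]: "step 0 0 = 0"
  by (simp add: zero_prod_def)

lemma vec_of_subst4_word:
  "\<forall>a\<in>set u. a \<le> 3 \<Longrightarrow> vec_of (subst4_word u) = step 0 (vec_of u)"
proof (induction u)
  case Nil
  show ?case by (simp add: subst4_word_def)
next
  case (Cons a u)
  have "vec_of (subst4_word [a]) = step 0 (vec_of [a])"
    using Cons.prems by (auto simp: subst4_word_def subst4_def vec_of_def)
  moreover have "subst4_word (a # u) = subst4_word [a] @ subst4_word u"
    using subst4_word_append[of "[a]" u] by simp
  moreover have "vec_of (a # u) = vec_of [a] + vec_of u"
    using vec_of_append[of "[a]" u] by simp
  ultimately show ?case
    using Cons step_add[of 0 0] by (simp add: vec_of_append)
qed

definition pvec :: "nat \<Rightarrow> vec" where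
  "pvec n = vec_of (stake n fourbonacci_word)"

lemma pvec_zero [simp]: "pvec 0 = 0"
  by (simp add: pvec_def)

lemma set_stake_le_3: "a \<in> set (stake n fourbonacci_word) \<Longrightarrow> a \<le> 3"
  using letter_le_3 by (auto simp: in_set_conv_nth letter_def)

lemma len_vec_of: "\<forall>a\<in>set u. a \<le> 3 \<Longrightarrow> len (vec_of u) = int (length u)"
proof (induction u)
  case (Cons a u)
  then have "a = 0 \<or> a = 1 \<or> a = 2 \<or> a = 3" by auto
  with Cons show ?case by (auto simp: vec_of_def)
qed simp

lemma len_pvec [simp]: "len (pvec n) = int n"
  using len_vec_of[of "stake n fourbonacci_word"] set_stake_le_3 by (simp add: pvec_def)

lemma pvec_child:
  assumes "child i d j"
  shows "pvec j = step (int d) (pvec i)"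
proof -
  have *: "pvec (img i) = step 0 (pvec i)"
    unfolding pvec_def stake_img by (rule vec_of_subst4_word) (use set_stake_le_3 in blast)
  have "pvec (Suc (img i)) = pvec (img i) + (1, 0, 0, 0)"
    unfolding pvec_def stake_Suc by (simp add: vec_of_append letter_img[unfolded letter_def]) (simp add: vec_of_def)
  with * have "pvec (Suc (img i)) = step 1 (pvec i)"
    by (cases "pvec i") simp
  with * assms show ?thesis by (auto simp: child_def)
qed

text \<open>The difference is the Parikh vector of the factor between the two positions. It makes
  deviations monotone in each of their three indices.\<close>

lemma pvec_mono:
  assumes "m \<le> n"
  obtains x y z w where "pvec n = pvec m + (x, y, z, w)" "x \<ge> 0" "y \<ge> 0" "z \<ge> 0" "w \<ge> 0"
    "x + y + z + w = int n - int m"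
proof -
  let ?u = "stake (n - m) (sdrop m fourbonacci_word)"
  have eq: "pvec n = pvec m + vec_of ?u"
    using assms by (simp add: pvec_def stake_add flip: vec_of_append)
  moreover from arg_cong[OF eq, of len] have "len (vec_of ?u) = int n - int m" by simp
  ultimately show thesis by (intro that) (auto simp: vec_of_def)
qed

definition dev :: "nat \<Rightarrow> nat \<Rightarrow> nat \<Rightarrow> vec" where
  "dev i n k = pvec k - pvec i - pvec n"

lemma len_dev [simp]: "len (dev i n k) = int k - int i - int n"
  by (simp add: dev_def)

lemma dev_child:
  assumes "child i a i'" "child n b n'" "child k c k'"
  shows "dev i' n' k' = step (int c - int a - int b) (dev i n k)"
  using assms by (simp add: dev_def pvec_child step_diff)

text \<open>A factor of length \<open>n\<close> starting at \<open>i\<close> has Parikh vector \<open>pvec n + dev i n (i + n)\<close>.\<close>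

lemma abelian_complexity_eq_card_dev:
  "abelian_complexity fourbonacci_word n = card {s. len s = 0 \<and> (\<exists>i k. dev i n k = s)}"
proof -
  let ?f = "\<lambda>(x, y, z, w). (int x, int y, int z, int w) - pvec n"
  have dev_factor: "dev i n (i + n) = ?f (parikh (stake n (sdrop i fourbonacci_word)))" for i
  proof -
    have "pvec (i + n) = pvec i + vec_of (stake n (sdrop i fourbonacci_word))"
      by (simp add: pvec_def vec_of_append flip: stake_add)
    then show ?thesis by (simp add: dev_def vec_of_def parikh_def)
  qed
  have factors: "factors_of_length fourbonacci_word n = range (\<lambda>i. stake n (sdrop i fourbonacci_word))"
    by (auto simp: factors_of_length_def)
  have "{s. len s = 0 \<and> (\<exists>i k. dev i n k = s)} = range (\<lambda>i. dev i n (i + n))"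
  proof (intro set_eqI iffI)
    fix s assume "s \<in> {s. len s = 0 \<and> (\<exists>i k. dev i n k = s)}"
    then obtain i k where ik: "dev i n k = s" "len s = 0" by blast
    then have "k = i + n" using len_dev[of i n k] by simp
    with ik show "s \<in> range (\<lambda>i. dev i n (i + n))" by blast
  next
    fix s assume "s \<in> range (\<lambda>i. dev i n (i + n))"
    then obtain i where "s = dev i n (i + n)" by blast
    then show "s \<in> {s. len s = 0 \<and> (\<exists>i k. dev i n k = s)}"
      by (intro CollectI conjI exI[of _ i] exI[of _ "i + n"]) simp_all
  qed
  also have "\<dots> = ?f ` parikh ` factors_of_length fourbonacci_word n"
    unfolding factors dev_factor image_image ..
  finally have "card {s. len s = 0 \<and> (\<exists>i k. dev i n k = s)} =
      card (?f ` parikh ` factors_of_length fourbonacci_word n)" by simp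
  also have "\<dots> = card (parikh ` factors_of_length fourbonacci_word n)"
    by (rule card_image) (auto intro!: inj_onI)
  finally show ?thesis by (simp add: abelian_complexity_def)
qed

subsection \<open>Bounded deviations\<close>

text \<open>A row \<open>(y, z, w, a, b)\<close> stands for the vectors \<open>(x, y, z, w)\<close> with \<open>a \<le> x \<le> b\<close>. Together they
  are all vectors reachable from \<open>0\<close> by maps \<open>step t\<close> with \<open>-2 \<le> t \<le> 1\<close> that stay within
  \<open>-3 \<le> len s \<le> 4\<close>.\<close>

definition dev_rows :: "(int \<times> int \<times> int \<times> int \<times> int) list" where
  "dev_rows = [
    (-3,0,1,-1,-1), (-2,-1,0,0,0), (-2,-1,1,-1,0), (-2,-1,2,-2,0), (-2,0,-1,0,0), (-2,0,0,-1,0),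
    (-2,0,1,-2,1), (-2,0,2,-3,0), (-2,1,-1,-1,0), (-2,1,0,-2,1), (-2,1,1,-3,1), (-1,-2,0,0,0),
    (-1,-2,1,-1,0), (-1,-1,-1,0,0), (-1,-1,0,-1,1), (-1,-1,1,-2,2), (-1,-1,2,-3,2), (-1,0,-1,-1,1),
    (-1,0,0,-2,2), (-1,0,1,-3,2), (-1,0,2,-2,3), (-1,1,-2,-1,0), (-1,1,-1,-2,2), (-1,1,0,-3,2),
    (-1,1,1,-3,3), (-1,1,2,-1,2), (-1,2,-1,-3,2), (-1,2,0,-2,2), (-1,2,1,-1,2), (0,-2,-1,0,0),
    (0,-2,0,-1,1), (0,-2,1,-2,1), (0,-1,-1,-1,1), (0,-1,0,-2,2), (0,-1,1,-3,3), (0,-1,2,-2,3),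
    (0,0,-2,-1,0), (0,0,-1,-2,2), (0,0,0,-3,3), (0,0,1,-3,3), (0,0,2,-1,2), (0,1,-2,-2,1),
    (0,1,-1,-3,3), (0,1,0,-3,3), (0,1,1,-2,2), (0,1,2,0,1), (0,2,-1,-2,3), (0,2,0,-1,2),
    (0,2,1,-1,1), (1,-2,0,-2,1), (1,-2,1,-2,2), (1,-1,-1,-2,2), (1,-1,0,-3,3), (1,-1,1,-2,3),
    (1,-1,2,-1,2), (1,0,-2,-2,1), (1,0,-1,-3,3), (1,0,0,-2,3), (1,0,1,-2,2), (1,0,2,0,1),
    (1,1,-2,-2,2), (1,1,-1,-2,3), (1,1,0,-2,2), (1,1,1,-1,1), (1,2,-1,-1,2), (1,2,0,0,1),
    (1,2,1,0,0), (2,-1,-1,-1,3), (2,-1,0,-1,3), (2,-1,1,-1,2), (2,-1,2,0,1), (2,0,-1,-1,3),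
    (2,0,0,-1,2), (2,0,1,0,1), (2,1,-2,0,3), (2,1,-1,-1,2), (2,1,0,0,1), (2,1,1,0,0), (2,2,-1,0,1),
    (3,-1,0,2,2), (3,0,-1,1,2), (3,0,0,1,1), (3,1,-1,1,1)]"

fun in_rows :: "(int \<times> int \<times> int \<times> int \<times> int) list \<Rightarrow> vec \<Rightarrow> bool" where
  "in_rows [] s = False"
| "in_rows ((y', z', w', a, b) # r) (x, y, z, w) =
     (if y = y' then if z = z' then if w = w' then a \<le> x \<and> x \<le> b
        else in_rows r (x, y, z, w) else in_rows r (x, y, z, w) else in_rows r (x, y, z, w))"

fun rows_vecs :: "(int \<times> int \<times> int \<times> int \<times> int) list \<Rightarrow> vec list" where
  "rows_vecs [] = []"
| "rows_vecs ((y, z, w, a, b) # r) = map (\<lambda>x. (x, y, z, w)) [a..b] @ rows_vecs r"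

lemma in_rows_vecs: "in_rows r s \<Longrightarrow> s \<in> set (rows_vecs r)"
  by (induction r s rule: in_rows.induct) (auto split: if_splits)

definition potential :: "vec \<Rightarrow> int" where
  "potential = (\<lambda>(x, y, z, w). 15 * x + 14 * y + 12 * z + 8 * w)"

text \<open>Collects what is read off from the table: coordinate bounds for deviations at the edge
  of the window, potential bounds placing balanced vectors in the kept range, and the closure
  condition that drives \<open>dev_in_rows\<close>.\<close>

definition row_ok :: "vec \<Rightarrow> bool" where
  "row_ok = (\<lambda>(x, y, z, w). -3 \<le> y \<and> y \<le> 3 \<and> -2 \<le> z \<and> z \<le> 2 \<and> -2 \<le> w \<and> w \<le> 2 \<and>
    (len (x, y, z, w) = 0 \<longrightarrow> -16 \<le> potential (x, y, z, w) \<and> potential (x, y, z, w) \<le> 32) \<and>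
    (\<forall>t\<in>{-2, -1, 0, 1}. -3 \<le> len (step t (x, y, z, w)) \<and> len (step t (x, y, z, w)) \<le> 4 \<longrightarrow>
       in_rows dev_rows (step t (x, y, z, w))))"

lemma row_ok_rows_vecs: "list_all row_ok (rows_vecs dev_rows)"
  by code_simp

lemma zero_in_dev_rows: "in_rows dev_rows (0, 0, 0, 0)"
  by code_simp

lemma row_ok_dev_rows: "in_rows dev_rows s \<Longrightarrow> row_ok s"
  using in_rows_vecs[of dev_rows s] row_ok_rows_vecs by (simp add: list_all_iff)

lemma child_offset:
  assumes "child i a i'" "child n b n'" "child k c k'"
  shows "int c - int a - int b \<in> {-2, -1, 0, 1}"
  using child_digit[OF assms(1)] child_digit[OF assms(2)] child_digit[OF assms(3)] by auto

text \<open>Lowering \<open>k\<close> until the length is 4 removes a nonnegative nonzero vector,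
  which reduces deviations above the window to its edge.\<close>

lemma dev_shift_above:
  assumes "int k - int i - int n > 4"
  obtains x y z w where "dev i n k = dev i n (i + n + 4) + (x, y, z, w)"
    "x \<ge> 0" "y \<ge> 0" "z \<ge> 0" "w \<ge> 0" "x + y + z + w > 0" "i + n + 4 < k"
proof -
  have less: "i + n + 4 < k" using assms by linarith
  then obtain x y z w where "pvec k = pvec (i + n + 4) + (x, y, z, w)"
      "x \<ge> 0" "y \<ge> 0" "z \<ge> 0" "w \<ge> 0" "x + y + z + w = int k - int (i + n + 4)"
    by (metis pvec_mono less_imp_le)
  with less show thesis by (intro that[of x y z w]) (auto simp: dev_def)
qed

lemma dev_shift_below:
  assumes "int k - int i - int n < -3"
  obtains j m x y z w where "dev i n k = dev j m k - (x, y, z, w)"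
    "x \<ge> 0" "y \<ge> 0" "z \<ge> 0" "w \<ge> 0" "x + y + z + w > 0" "j + m < i + n" "int k - int j - int m = -3"
proof -
  \<comment> \<open>\<open>n\<close> is shortened first; \<open>i\<close> is cut to
    \<open>k + 3\<close> only when it exceeds that value. In both cases
    \<open>j + m = k + 3\<close>, so the length becomes -3.\<close>
  define j m where "j = min i (k + 3)" and "m = k + 3 - j"
  have jm: "j \<le> i" "m \<le> n" "j + m < i + n" "j + m = k + 3"
    using assms unfolding j_def m_def by auto
  obtain x y z w where 1: "pvec i = pvec j + (x, y, z, w)"
      "x \<ge> 0" "y \<ge> 0" "z \<ge> 0" "w \<ge> 0" "x + y + z + w = int i - int j"
    by (rule pvec_mono[OF jm(1)])
  obtain x' y' z' w' where 2: "pvec n = pvec m + (x', y', z', w')"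
      "x' \<ge> 0" "y' \<ge> 0" "z' \<ge> 0" "w' \<ge> 0" "x' + y' + z' + w' = int n - int m"
    by (rule pvec_mono[OF jm(2)])
  have "dev i n k = dev j m k - (x + x', y + y', z + z', w + w')"
    unfolding dev_def 1(1) 2(1) by (cases "pvec k"; cases "pvec j"; cases "pvec m") simp
  then show thesis by (rule that) (use jm 1(2-) 2(2-) in auto)
qed

text \<open>Outside the window \<open>-3 \<le> len s \<le> 4\<close> the length moves away from it, because by monotonicity
  in \<open>i\<close>, \<open>n\<close> and \<open>k\<close> it suffices to check this on the boundary of the window.\<close>

lemma dev_in_rows:
  assumes "-3 \<le> int k - int i - int n" "int k - int i - int n \<le> 4"
  shows "in_rows dev_rows (dev i n k)"
  using assms
proof (induction "i + n + k" arbitrary: i n k rule: less_induct)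
  case less
  show ?case
  proof (cases "i + n + k = 0")
    case True
    then show ?thesis using zero_in_dev_rows by (simp add: dev_def zero_prod_def)
  next
    case False
    obtain i' a where i: "child i' a i" using child_exists by blast
    obtain n' b where n: "child n' b n" using child_exists by blast
    obtain k' c where k: "child k' c k" using child_exists by blast
    define t where "t = int c - int a - int b"
    have t: "t \<in> {-2, -1, 0, 1}" unfolding t_def by (rule child_offset[OF i n k])
    have dev: "dev i n k = step t (dev i' n' k')"
      unfolding t_def by (rule dev_child[OF i n k])
    have len: "-3 \<le> len (step t (dev i' n' k'))" "len (step t (dev i' n' k')) \<le> 4"
      using less.prems unfolding dev[symmetric] by simp_all
    have sum: "i' + n' + k' < i + n + k"
      using False child_less[OF i] child_less[OF n] child_less[OF k]
        child_le[OF i] child_le[OF n] child_le[OF k] by linarith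
    \<comment> \<open>\<open>len (step t s) = 2 * len s - w + t\<close> with \<open>w\<close> the
      last coordinate of \<open>s\<close>. At length 4, \<open>w \<le> 2\<close> and
      \<open>t \<ge> -2\<close> keep the result at least 4, and a nonzero surplus pushes it above
      4.\<close>
    have "\<not> int k' - int i' - int n' > 4"
    proof
      assume "int k' - int i' - int n' > 4"
      then obtain x y z w where *: "dev i' n' k' = dev i' n' (i' + n' + 4) + (x, y, z, w)"
          "x \<ge> 0" "y \<ge> 0" "z \<ge> 0" "w \<ge> 0" "x + y + z + w > 0" "i' + n' + 4 < k'"
        by (rule dev_shift_above)
      have "in_rows dev_rows (dev i' n' (i' + n' + 4))"
        using sum *(7) by (intro less.hyps) auto
      then have "row_ok (dev i' n' (i' + n' + 4))" by (rule row_ok_dev_rows)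
      moreover have "len (dev i' n' (i' + n' + 4)) = 4" by simp
      ultimately show False
        using len(2) t * by (cases "dev i' n' (i' + n' + 4)") (auto simp: row_ok_def)
    qed
    \<comment> \<open>At length -3, \<open>w \<ge> -2\<close> and \<open>t \<le> 1\<close> keep the
      result at most -3, and subtracting a nonzero vector pushes it lower.\<close>
    moreover have "\<not> int k' - int i' - int n' < -3"
    proof
      assume "int k' - int i' - int n' < -3"
      then obtain j m x y z w where *: "dev i' n' k' = dev j m k' - (x, y, z, w)"
          "x \<ge> 0" "y \<ge> 0" "z \<ge> 0" "w \<ge> 0" "x + y + z + w > 0"
          "j + m < i' + n'" "int k' - int j - int m = -3"
        by (rule dev_shift_below)
      have "in_rows dev_rows (dev j m k')"
        using sum *(7,8) by (intro less.hyps) auto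
      then have "row_ok (dev j m k')" by (rule row_ok_dev_rows)
      moreover have "len (dev j m k') = -3" using *(8) by simp
      ultimately show False
        using len(1) t * by (cases "dev j m k'") (auto simp: row_ok_def)
    qed
    ultimately have "in_rows dev_rows (dev i' n' k')"
      using sum by (intro less.hyps) auto
    then have "row_ok (dev i' n' k')" by (rule row_ok_dev_rows)
    then show ?thesis
      using t len unfolding dev by (cases "dev i' n' k'") (auto simp: row_ok_def simp del: step.simps len.simps)
  qed
qed

definition keep :: "vec \<Rightarrow> bool" where
  "keep s \<longleftrightarrow> -16 \<le> potential s \<and> potential s \<le> 32"

lemma keep_dev_balanced: "len (dev i n k) = 0 \<Longrightarrow> keep (dev i n k)"
  using row_ok_dev_rows[OF dev_in_rows[of k i n]]
  by (cases "dev i n k") (auto simp: row_ok_def keep_def simp flip: len_dev)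

lemma potential_step: "potential (step t s) = 2 * potential s - len s + 15 * t"
  by (cases s) (simp add: potential_def)

text \<open>The potential, the length of the fourth substitution image, nearly doubles in every step.
  Hence deviations that leave the kept range never return to it.\<close>

lemma keep_parent:
  assumes "child i a i'" "child n b n'" "child k c k'" and keep: "keep (dev i' n' k')"
  shows "keep (dev i n k)"
proof -
  define t where "t = int c - int a - int b"
  have t: "t \<in> {-2, -1, 0, 1}" unfolding t_def by (rule child_offset[OF assms(1-3)])
  have pot: "-16 \<le> 2 * potential (dev i n k) - len (dev i n k) + 15 * t"
      "2 * potential (dev i n k) - len (dev i n k) + 15 * t \<le> 32"
    using keep dev_child[OF assms(1-3)] by (simp_all add: keep_def t_def potential_step)
  have bounds: "row_ok (dev i n k)" if "-3 \<le> int k - int i - int n" "int k - int i - int n \<le> 4" for i n k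
    using that by (intro row_ok_dev_rows dev_in_rows)
  consider "int k - int i - int n > 4" | "int k - int i - int n < -3"
    | "-3 \<le> int k - int i - int n" "int k - int i - int n \<le> 4" by linarith
  then show ?thesis
  proof cases
    \<comment> \<open>The potential is \<open>15 * l - y - 3 * z - 7 * w\<close> with
      \<open>l\<close> the length. Length 4 makes it at least 37, hence at least 74 - 4 - 30 = 40 >
      32 after the step; a surplus raises it further.\<close>
    case 1
    then obtain x y z w where *: "dev i n k = dev i n (i + n + 4) + (x, y, z, w)"
        "x \<ge> 0" "y \<ge> 0" "z \<ge> 0" "w \<ge> 0" "x + y + z + w > 0" "i + n + 4 < k"
      by (rule dev_shift_above)
    have "row_ok (dev i n (i + n + 4))" by (rule bounds) auto
    moreover have "len (dev i n (i + n + 4)) = 4" by simp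
    ultimately have False
      using pot t * by (cases "dev i n (i + n + 4)") (auto simp: row_ok_def potential_def)
    then show ?thesis ..
  next
    \<comment> \<open>Symmetrically, length -3 makes the potential at most -22, hence at most -44 +
      3 + 15 = -26 < -16 after the step.\<close>
    case 2
    then obtain j m x y z w where *: "dev i n k = dev j m k - (x, y, z, w)"
        "x \<ge> 0" "y \<ge> 0" "z \<ge> 0" "w \<ge> 0" "x + y + z + w > 0" "j + m < i + n" "int k - int j - int m = -3"
      by (rule dev_shift_below)
    have "row_ok (dev j m k)" by (rule bounds) (use *(8) in auto)
    moreover have "len (dev j m k) = -3" using *(8) by simp
    ultimately have False
      using pot t * by (cases "dev j m k") (auto simp: row_ok_def potential_def)
    then show ?thesis ..
  next
    case 3
    obtain x y z w where s: "dev i n k = (x, y, z, w)" by (cases "dev i n k")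
    define p l where "p = potential (x, y, z, w)" and "l = len (x, y, z, w)"
    have "l \<ge> -3" "l \<le> 4" using 3 unfolding l_def s[symmetric] by simp_all
    moreover have "p = 15 * l - y - 3 * z - 7 * w" by (simp add: p_def l_def potential_def)
    moreover have "-3 \<le> y" "y \<le> 3" "-2 \<le> z" "z \<le> 2" "-2 \<le> w" "w \<le> 2"
      using bounds[OF 3] by (simp_all add: s row_ok_def)
    moreover have "-16 \<le> 2 * p - l + 15 * t" "2 * p - l + 15 * t \<le> 32"
      using pot by (simp_all add: p_def l_def s)
    moreover have "-2 \<le> t" "t \<le> 1" using t by auto
    \<comment> \<open>For \<open>l\<close> from -2 to 3 the inequalities and integrality give both
      bounds; \<open>l = 4\<close> and \<open>l = -3\<close> contradict \<open>p \<ge> 37\<close>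
      and \<open>p \<le> -22\<close>.\<close>
    ultimately have "-16 \<le> p \<and> p \<le> 32" 
      by (cases "l = 4"; cases "l = -3"; linarith)
    then show ?thesis by (simp add: keep_def s p_def)
  qed
qed

subsection \<open>Covering and supporting sets of deviations\<close>

type_synonym elem = "vec \<times> nat \<times> nat"

definition dominates :: "elem \<Rightarrow> elem \<Rightarrow> bool" where
  "dominates = (\<lambda>(s, a, c) (s', a', c'). s = s' \<and> a \<le> a' \<and> c \<le> c')"

definition realized :: "nat \<Rightarrow> elem set" where
  "realized n = {(dev i n k, letter i, letter k) | i k. True}"

lemma realizedI: "(dev i n k, letter i, letter k) \<in> realized n"
  unfolding realized_def by blast

text \<open>Ignoring unkept deviations loses nothing, as they are neither balanced nor ancestors of
  balanced ones (\<open>keep_dev_balanced\<close>, \<open>keep_parent\<close>), and it lets finite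
  lists suffice.\<close>

definition covers :: "nat \<Rightarrow> elem list \<Rightarrow> bool" where
  "covers n C \<longleftrightarrow> (\<forall>e\<in>realized n. keep (fst e) \<longrightarrow> (\<exists>e'\<in>set C. dominates e' e))"

definition supports :: "nat \<Rightarrow> elem list \<Rightarrow> bool" where
  "supports n C \<longleftrightarrow> (\<forall>e\<in>set C. \<exists>e'\<in>realized n. dominates e' e)"

lemma dominates_trans: "dominates e e' \<Longrightarrow> dominates e' e'' \<Longrightarrow> dominates e e''"
  by (auto simp: dominates_def split: prod.splits)

definition balanced :: "elem list \<Rightarrow> vec list" where
  "balanced C = map fst (filter (\<lambda>e. len (fst e) = 0) C)"

lemma covers_upper:
  assumes "covers n C"
  shows "abelian_complexity fourbonacci_word n \<le> length (remdups (balanced C))"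
proof -
  have "{s. len s = 0 \<and> (\<exists>i k. dev i n k = s)} \<subseteq> set (balanced C)"
  proof
    fix s assume "s \<in> {s. len s = 0 \<and> (\<exists>i k. dev i n k = s)}"
    then obtain i k where s: "s = dev i n k" and zero: "len (dev i n k) = 0" by blast
    from zero have "keep (dev i n k)" by (rule keep_dev_balanced)
    then obtain e where "e \<in> set C" "dominates e (dev i n k, letter i, letter k)"
      using assms realizedI[of i n k] unfolding covers_def by (metis fst_conv)
    then have "e \<in> set C \<and> fst e = dev i n k" by (auto simp: dominates_def)
    with zero show "s \<in> set (balanced C)"
      unfolding s balanced_def by force
  qed
  then have "card {s. len s = 0 \<and> (\<exists>i k. dev i n k = s)} \<le> card (set (balanced C))"
    by (intro card_mono) simp_all
  then show ?thesis by (simp only: abelian_complexity_eq_card_dev length_remdups_card_conv)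
qed

text \<open>Serves the lower bound, because \<open>card\<close> of an infinite set is 0. Length 0 is
  inside the window, so the table contains all these vectors.\<close>

lemma finite_balanced_dev: "finite {s. len s = 0 \<and> (\<exists>i k. dev i n k = s)}"
proof (rule finite_subset)
  show "{s. len s = 0 \<and> (\<exists>i k. dev i n k = s)} \<subseteq> set (rows_vecs dev_rows)"
  proof
    fix s assume "s \<in> {s. len s = 0 \<and> (\<exists>i k. dev i n k = s)}"
    then obtain i k where s: "s = dev i n k" and "len (dev i n k) = 0" by blast
    then have "in_rows dev_rows (dev i n k)" by (intro dev_in_rows) auto
    then show "s \<in> set (rows_vecs dev_rows)" unfolding s by (rule in_rows_vecs)
  qed
qed simp

lemma supports_lower:
  assumes "supports n C"
  shows "length (remdups (balanced C)) \<le> abelian_complexity fourbonacci_word n"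
proof -
  have "set (balanced C) \<subseteq> {s. len s = 0 \<and> (\<exists>i k. dev i n k = s)}"
  proof
    fix s assume "s \<in> set (balanced C)"
    then obtain e where e: "e \<in> set C" "len s = 0" "fst e = s" by (auto simp: balanced_def)
    then obtain e' where "e' \<in> realized n" "dominates e' e"
      using assms unfolding supports_def by blast
    with e show "s \<in> {s. len s = 0 \<and> (\<exists>i k. dev i n k = s)}"
      by (auto simp: realized_def dominates_def split: prod.splits)
  qed
  then have "card (set (balanced C)) \<le> card {s. len s = 0 \<and> (\<exists>i k. dev i n k = s)}"
    by (intro card_mono finite_balanced_dev)
  then show ?thesis by (simp only: abelian_complexity_eq_card_dev length_remdups_card_conv)
qed

section \<open>Successors of an element under one digit\<close>

definition succs_at :: "int \<Rightarrow> int \<Rightarrow> int \<Rightarrow> int \<Rightarrow> nat \<Rightarrow> nat \<Rightarrow> elem list" where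
  "succs_at l x y z a c = ((l, x, y, z), 0, 0) #
     (if a < 3 then [((l - 1, x, y, z), a + 1, 0)] else []) @
     (if c < 3 then [((l + 1, x, y, z), 0, c + 1)] else []) @
     (if a < 3 \<and> c < 3 then [((l, x, y, z), a + 1, c + 1)] else [])"

text \<open>The first coordinate of \<open>step (-d)\<close> is computed once and handed to
  \<open>succs_at\<close>, which varies the digits of the two positions: a digit 1 at
  \<open>i\<close> lowers it, a digit 1 at \<open>k\<close> raises it, and either needs a letter
  below 3.\<close>

fun succs :: "nat \<Rightarrow> elem \<Rightarrow> elem list" where
  "succs d ((x, y, z, w), a, c) = succs_at (x + y + z + w - int d) x y z a c"

lemma succs_iff:
  "e \<in> set (succs d (s, a, c)) \<longleftrightarrow>
     (\<exists>p q. (p = 0 \<or> p = 1 \<and> a < 3) \<and> (q = 0 \<or> q = 1 \<and> c < 3) \<and>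
        e = (step (int q - int p - int d) s, if p = 0 then 0 else a + 1, if q = 0 then 0 else c + 1))"
proof -
  have digits: "(\<exists>p q. (p = 0 \<or> p = 1 \<and> A) \<and> (q = 0 \<or> q = 1 \<and> B) \<and> R p q) \<longleftrightarrow>
      R 0 0 \<or> A \<and> R 1 0 \<or> B \<and> R 0 1 \<or> A \<and> B \<and> R 1 1" for A B and R :: "nat \<Rightarrow> nat \<Rightarrow> bool"
    by blast
  show ?thesis unfolding digits by (cases s) (auto simp: succs_at_def)
qed

text \<open>The monotonicity that makes \<^const>\<open>dominates\<close> the right order: a smaller letter admits more
  continuations.\<close>

lemma succs_dominates:
  assumes "dominates e e'" "f' \<in> set (succs d e')"
  shows "\<exists>f\<in>set (succs d e). dominates f f'"
proof -
  obtain s a c a' c' where e: "e = (s, a, c)" "e' = (s, a', c')" "a \<le> a'" "c \<le> c'"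
    using assms(1) by (auto simp: dominates_def split: prod.splits)
  obtain p q where pq: "p = 0 \<or> p = 1 \<and> a' < 3" "q = 0 \<or> q = 1 \<and> c' < 3"
      "f' = (step (int q - int p - int d) s, if p = 0 then 0 else a' + 1, if q = 0 then 0 else c' + 1)"
    using assms(2) unfolding e succs_iff by blast
  define f where "f = (step (int q - int p - int d) s, if p = 0 then 0 else a + 1, if q = 0 then 0 else c + 1)"
  have "f \<in> set (succs d e)"
    unfolding e succs_iff f_def using pq(1,2) e(3,4) by (intro exI[of _ p] exI[of _ q]) auto
  moreover have "dominates f f'" using e(3,4) unfolding f_def pq(3) dominates_def by auto
  ultimately show ?thesis by blast
qed

text \<open>A letter below 3 is exactly what offset 1 requires, so every formal successor belongs to
  actual positions \<open>img i + p\<close> and \<open>img k + q\<close>.\<close>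

lemma realized_child_succs:
  assumes "child n d n'" "e \<in> realized n" "f \<in> set (succs d e)"
  shows "f \<in> realized n'"
proof -
  obtain i k where e: "e = (dev i n k, letter i, letter k)"
    using assms(2) by (auto simp: realized_def)
  obtain p q where pq: "p = 0 \<or> p = 1 \<and> letter i < 3" "q = 0 \<or> q = 1 \<and> letter k < 3"
      "f = (step (int q - int p - int d) (dev i n k), if p = 0 then 0 else letter i + 1,
        if q = 0 then 0 else letter k + 1)"
    using assms(3) unfolding e succs_iff by blast
  have ch: "child i p (img i + p)" "child k q (img k + q)"
    using pq by (auto simp: child_def)
  have "f = (dev (img i + p) n' (img k + q), letter (img i + p), letter (img k + q))"
    using pq(3) dev_child[OF ch(1) assms(1) ch(2)] letter_child[OF ch(1)] letter_child[OF ch(2)] by simp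
  then show ?thesis unfolding realized_def by blast
qed

text \<open>Both positions are replaced by their parents; \<open>keep_parent\<close> ensures that
  the earlier deviation is kept too.\<close>

lemma realized_childE:
  assumes "child n d n'" "f \<in> realized n'" "keep (fst f)"
  obtains e where "e \<in> realized n" "keep (fst e)" "f \<in> set (succs d e)"
proof -
  obtain i' k' where f: "f = (dev i' n' k', letter i', letter k')"
    using assms(2) by (auto simp: realized_def)
  obtain i p where i: "child i p i'" using child_exists by blast
  obtain k q where k: "child k q k'" using child_exists by blast
  show thesis
  proof (rule that)
    show "(dev i n k, letter i, letter k) \<in> realized n" by (rule realizedI)
    show "keep (fst (dev i n k, letter i, letter k))"
      using keep_parent[OF i assms(1) k] assms(3) by (simp add: f)
    show "f \<in> set (succs d (dev i n k, letter i, letter k))"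
      unfolding succs_iff f dev_child[OF i assms(1) k] letter_child[OF i] letter_child[OF k]
      using child_digit[OF i] child_digit[OF k] by (intro exI[of _ p] exI[of _ q]) auto
  qed
qed

text \<open>Sets of elements are looked up in tries of depth four indexed by the coordinates, which
  lie between \<open>-2\<close> and \<open>2\<close>; other elements are not stored.\<close>

datatype trie = Leaf "(nat \<times> nat) list" | Node trie trie trie trie trie

text \<open>One constant for the empty trie of every depth; the evaluation rules match on it without
  unfolding.\<close>

definition Emp :: trie where
  "Emp = Leaf []"

fun branch :: "int \<Rightarrow> trie \<Rightarrow> trie" where
  "branch k (Leaf x) = Emp"
| "branch k (Node a b c d e) =
     (if k = -2 then a else if k = -1 then b else if k = 0 then c else if k = 1 then d
      else if k = 2 then e else Emp)"

fun lookup :: "int list \<Rightarrow> trie \<Rightarrow> (nat \<times> nat) list" where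
  "lookup [] (Leaf x) = x"
| "lookup [] (Node a b c d e) = []"
| "lookup (k # ks) t = lookup ks (branch k t)"

definition change :: "int \<Rightarrow> trie \<Rightarrow> trie \<Rightarrow> trie" where
  "change k u t = Node (if k = -2 then u else branch (-2) t) (if k = -1 then u else branch (-1) t)
     (if k = 0 then u else branch 0 t) (if k = 1 then u else branch 1 t) (if k = 2 then u else branch 2 t)"

fun put :: "int list \<Rightarrow> nat \<times> nat \<Rightarrow> trie \<Rightarrow> trie" where
  "put [] p (Leaf x) = Leaf (p # x)"
| "put [] p (Node a b c d e) = Node a b c d e"
| "put (k # ks) p t = change k (put ks p (branch k t)) t"

lemma lookup_Emp [simp]: "lookup ks Emp = []"
  by (induction ks) (simp_all add: Emp_def)

lemma branch_change: "branch l (change k u t) = u \<and> l = k \<or> branch l (change k u t) \<in> {branch l t, Emp}"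
  by (simp add: change_def)

text \<open>This direction gives soundness: whatever is found has been inserted. An element lost
  outside the index range can only make a check fail or leave a redundant entry.\<close>

lemma lookup_put: "r \<in> set (lookup ls (put ks p t)) \<Longrightarrow> ls = ks \<and> r = p \<or> r \<in> set (lookup ls t)"
proof (induction ks arbitrary: ls t)
  case Nil
  then show ?case by (cases t; cases ls) auto
next
  case (Cons k ks)
  show ?case
  proof (cases ls)
    case Nil
    with Cons.prems show ?thesis by (simp add: change_def)
  next
    case (Cons l ls')
    with Cons.prems Cons.IH[of ls' "branch k t"] branch_change[of l k "put ks p (branch k t)" t]
    show ?thesis by auto
  qed
qed

fun ins :: "elem \<Rightarrow> trie \<Rightarrow> trie" where
  "ins ((x, y, z, w), p) t = put [x, y, z, w] p t"

fun any_le :: "(nat \<times> nat) list \<Rightarrow> nat \<Rightarrow> nat \<Rightarrow> bool" where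
  "any_le [] a c = False"
| "any_le ((a', c') # r) a c = (if a' \<le> a then if c' \<le> c then True else any_le r a c else any_le r a c)"

fun hit :: "trie \<Rightarrow> elem \<Rightarrow> bool" where
  "hit t ((x, y, z, w), a, c) = any_le (lookup [x, y, z, w] t) a c"

definition stored :: "trie \<Rightarrow> elem set" where
  "stored t = {((x, y, z, w), p) | x y z w p. p \<in> set (lookup [x, y, z, w] t)}"

lemma stored_Emp [simp]: "stored Emp = {}"
  unfolding stored_def lookup_Emp by simp

lemma stored_ins: "stored (ins e t) \<subseteq> insert e (stored t)"
proof
  obtain x y z w p where e: "e = ((x, y, z, w), p)" by (cases e) auto
  fix f assume "f \<in> stored (ins e t)"
  then obtain x' y' z' w' p' where f: "f = ((x', y', z', w'), p')"
      "p' \<in> set (lookup [x', y', z', w'] (put [x, y, z, w] p t))"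
    unfolding stored_def e ins.simps by blast
  from lookup_put[OF f(2)] show "f \<in> insert e (stored t)"
    unfolding f(1) e stored_def by blast
qed

lemma any_le_iff: "any_le r a c \<longleftrightarrow> (\<exists>(a', c')\<in>set r. a' \<le> a \<and> c' \<le> c)"
  by (induction r a c rule: any_le.induct) auto

lemma hit_stored: "hit t e \<Longrightarrow> \<exists>e'\<in>stored t. dominates e' e"
proof -
  assume hit: "hit t e"
  obtain x y z w a c where e: "e = ((x, y, z, w), a, c)" by (cases e) auto
  then obtain a' c' where "(a', c') \<in> set (lookup [x, y, z, w] t)" "a' \<le> a" "c' \<le> c"
    using hit by (auto simp: any_le_iff simp del: lookup.simps)
  then show ?thesis
    by (intro bexI[of _ "((x, y, z, w), a', c')"]) (simp_all add: dominates_def e stored_def del: lookup.simps)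
qed

text \<open>\<open>force\<close> marks the arguments that the simplifier normalizes when it runs the checks below;
  the congruence rules make it skip all others.\<close>

definition force :: "('a \<Rightarrow> 'b) \<Rightarrow> 'a \<Rightarrow> 'b" where
  "force f x = f x"

fun build :: "elem list \<Rightarrow> trie \<Rightarrow> trie" where
  "build [] t = t"
| "build (e # es) t = force (build es) (ins e t)"

lemma stored_build: "stored (build es t) \<subseteq> set es \<union> stored t"
proof (induction es arbitrary: t)
  case (Cons e es)
  have "stored (build (e # es) t) \<subseteq> set es \<union> stored (ins e t)"
    using Cons by (simp add: force_def)
  then show ?case using stored_ins[of e t] by auto
qed simp

text \<open>A work list: \<open>C\<close> holds the elements still to be expanded, \<open>A\<close>
  the successors still to be tested.\<close>

fun succs_hit :: "nat \<Rightarrow> elem list \<Rightarrow> elem list \<Rightarrow> trie \<Rightarrow> bool" where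
  "succs_hit d [] [] t = True"
| "succs_hit d (e # C) [] t = force (\<lambda>A. succs_hit d C A t) (succs d e)"
| "succs_hit d C (e # A) t =
     (if hit t e then succs_hit d C A t else if keep (fst e) then False else succs_hit d C A t)"

lemma succs_hit_iff:
  "succs_hit d C A t \<longleftrightarrow>
     (\<forall>f\<in>set A \<union> (\<Union>e\<in>set C. set (succs d e)). keep (fst f) \<longrightarrow> hit t f)"
  by (induction d C A t rule: succs_hit.induct) (auto simp: force_def)

section \<open>Soundness of the transition checks\<close>

definition upper_step :: "nat \<Rightarrow> elem list \<Rightarrow> elem list \<Rightarrow> bool" where
  "upper_step d C C' = force (succs_hit d C []) (build C' Emp)"

text \<open>Domination preserves the vector and hence \<open>keep\<close>, so the successor of
  \<open>e0\<close> that dominates \<open>f\<close> has been checked; transitivity does the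
  rest.\<close>

lemma upper_step_dominates:
  assumes "upper_step d C C'" "e0 \<in> set C" "dominates e0 e" "f \<in> set (succs d e)" "keep (fst f)"
  shows "\<exists>f'\<in>set C'. dominates f' f"
proof -
  obtain f0 where f0: "f0 \<in> set (succs d e0)" "dominates f0 f"
    using succs_dominates[OF assms(3,4)] by blast
  have "keep (fst f0)" using assms(5) f0(2) by (auto simp: dominates_def split: prod.splits)
  then have "hit (build C' Emp) f0"
    using assms(1,2) f0(1) by (auto simp: upper_step_def force_def succs_hit_iff)
  then obtain f1 where "f1 \<in> stored (build C' Emp)" "dominates f1 f0"
    using hit_stored by blast
  moreover from this have "f1 \<in> set C'" using stored_build[of C' Emp] by auto
  ultimately show ?thesis using dominates_trans f0(2) by blast
qed

lemma covers_child:
  assumes "covers n C" "child n d n'" "upper_step d C C'"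
  shows "covers n' C'"
  unfolding covers_def
proof (intro ballI impI)
  fix f assume f: "f \<in> realized n'" "keep (fst f)"
  obtain e where e: "e \<in> realized n" "keep (fst e)" "f \<in> set (succs d e)"
    using realized_childE[OF assms(2) f] by blast
  obtain e0 where "e0 \<in> set C" "dominates e0 e"
    using assms(1) e(1,2) unfolding covers_def by blast
  then show "\<exists>e'\<in>set C'. dominates e' f"
    using upper_step_dominates[OF assms(3) _ _ e(3) f(2)] by blast
qed

text \<open>0 is its own child under the digit 0, so no smaller number is available; the induction
  runs over \<open>i + k\<close> instead and uses that \<open>C\<close> is closed under this
  digit.\<close>

lemma covers_zero:
  assumes "upper_step 0 C C" "((0, 0, 0, 0), 0, 0) \<in> set C"
  shows "covers 0 C"
proof -
  have "keep (dev i 0 k) \<longrightarrow> (\<exists>e\<in>set C. dominates e (dev i 0 k, letter i, letter k))" for i k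
  proof (induction "i + k" arbitrary: i k rule: less_induct)
    case less
    show ?case
    proof (cases "i + k = 0")
      case True
      then show ?thesis using assms(2)
        by (intro impI bexI[of _ "((0, 0, 0, 0), 0, 0)"]) (auto simp: dominates_def dev_def zero_prod_def)
    next
      case False
      obtain i' p where i: "child i' p i" using child_exists by blast
      obtain k' q where k: "child k' q k" using child_exists by blast
      have sum: "i' + k' < i + k"
        using False child_less[OF i] child_less[OF k] child_le[OF i] child_le[OF k] by linarith
      show ?thesis
      proof
        assume keep: "keep (dev i 0 k)"
        have "keep (dev i' 0 k')" by (rule keep_parent[OF i child_zero k keep])
        then obtain e0 where e0: "e0 \<in> set C" "dominates e0 (dev i' 0 k', letter i', letter k')"
          using less[OF sum] by blast
        have "(dev i 0 k, letter i, letter k) \<in> set (succs 0 (dev i' 0 k', letter i', letter k'))"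
          unfolding succs_iff dev_child[OF i child_zero k] letter_child[OF i] letter_child[OF k]
          using child_digit[OF i] child_digit[OF k] by (intro exI[of _ p] exI[of _ q]) auto
        from upper_step_dominates[OF assms(1) e0 this]
        show "\<exists>e\<in>set C. dominates e (dev i 0 k, letter i, letter k)" using keep by simp
      qed
    qed
  qed
  then show ?thesis unfolding covers_def realized_def by auto
qed

fun build_succs :: "nat \<Rightarrow> elem list \<Rightarrow> elem list \<Rightarrow> trie \<Rightarrow> trie" where
  "build_succs d [] [] t = t"
| "build_succs d (e # C) [] t = force (\<lambda>A. build_succs d C A t) (succs d e)"
| "build_succs d C (e # A) t =
     (if hit t e then build_succs d C A t else force (build_succs d C A) (ins e t))"

lemma stored_build_succs:
  "stored (build_succs d C A t) \<subseteq> set A \<union> (\<Union>e\<in>set C. set (succs d e)) \<union> stored t"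
proof (induction d C A t rule: build_succs.induct)
  case (3 d C e A t)
  then show ?case using stored_ins[of e t] by (auto simp: force_def split: if_splits)
qed (auto simp: force_def)

fun all_hit :: "elem list \<Rightarrow> trie \<Rightarrow> bool" where
  "all_hit [] t = True"
| "all_hit (e # es) t = (if hit t e then all_hit es t else False)"

lemma all_hit_iff: "all_hit es t \<longleftrightarrow> (\<forall>e\<in>set es. hit t e)"
  by (induction es) auto

definition lower_step :: "nat \<Rightarrow> elem list \<Rightarrow> elem list \<Rightarrow> bool" where
  "lower_step d C C' = force (all_hit C') (build_succs d C [] Emp)"

lemma supports_succs:
  assumes "supports n C" "child n d n'" "e \<in> set C" "f \<in> set (succs d e)"
  shows "\<exists>e'\<in>realized n'. dominates e' f"
proof -
  obtain e0 where e0: "e0 \<in> realized n" "dominates e0 e"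
    using assms(1,3) unfolding supports_def by blast
  obtain f0 where "f0 \<in> set (succs d e0)" "dominates f0 f"
    using succs_dominates[OF e0(2) assms(4)] by blast
  with realized_child_succs[OF assms(2) e0(1)] show ?thesis by blast
qed

lemma supports_child:
  assumes "supports n C" "child n d n'" "lower_step d C C'"
  shows "supports n' C'"
  unfolding supports_def
proof
  fix f assume "f \<in> set C'"
  then have "hit (build_succs d C [] Emp) f"
    using assms(3) by (simp add: lower_step_def force_def all_hit_iff)
  then obtain f0 where f0: "f0 \<in> stored (build_succs d C [] Emp)" "dominates f0 f"
    using hit_stored by blast
  then obtain e where "e \<in> set C" "f0 \<in> set (succs d e)"
    using stored_build_succs[of d C "[]" Emp] by auto
  then have "\<exists>e'\<in>realized n'. dominates e' f0" by (rule supports_succs[OF assms(1,2)])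
  with f0(2) show "\<exists>e'\<in>realized n'. dominates e' f" using dominates_trans by blast
qed

text \<open>Collects the kept successors in \<open>r\<close>, dropping those dominated by earlier
  ones; the trie \<open>t\<close> serves as an index of \<open>r\<close>.\<close>

fun next_elems :: "nat \<Rightarrow> elem list \<Rightarrow> elem list \<Rightarrow> elem list \<Rightarrow> trie \<Rightarrow> elem list" where
  "next_elems d [] [] r t = r"
| "next_elems d (e # C) [] r t = force (\<lambda>A. next_elems d C A r t) (succs d e)"
| "next_elems d C (e # A) r t =
     (if hit t e then next_elems d C A r t
      else if keep (fst e) then force (next_elems d C A (e # r)) (ins e t)
      else next_elems d C A r t)"

lemma set_next_elems:
  "set (next_elems d C A r t) \<subseteq> set A \<union> (\<Union>e\<in>set C. set (succs d e)) \<union> set r"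
  by (induction d C A r t rule: next_elems.induct) (auto simp: force_def split: if_splits)

lemma supports_next_elems:
  assumes "supports n C" "child n d n'"
  shows "supports n' (next_elems d C [] [] Emp)"
  unfolding supports_def
proof
  fix f assume "f \<in> set (next_elems d C [] [] Emp)"
  then obtain e where "e \<in> set C" "f \<in> set (succs d e)"
    using set_next_elems[of d C "[]" "[]" Emp] by auto
  then show "\<exists>e'\<in>realized n'. dominates e' f" by (rule supports_succs[OF assms])
qed

text \<open>As 0 is its own child, repeated steps with the digit 0 turn a supporting list for 0 into
  further ones, the last of which has to dominate \<open>C'\<close>.\<close>

fun iterates_hit :: "nat \<Rightarrow> elem list \<Rightarrow> elem list \<Rightarrow> bool" where
  "iterates_hit 0 C C' = force (all_hit C') (build C Emp)"
| "iterates_hit (Suc n) C C' = force (\<lambda>B. iterates_hit n B C') (next_elems 0 C [] [] Emp)"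

lemma supports_iterates_hit: "iterates_hit m C C' \<Longrightarrow> supports 0 C \<Longrightarrow> supports 0 C'"
proof (induction m arbitrary: C)
  case 0
  show ?case
    unfolding supports_def
  proof
    fix f assume "f \<in> set C'"
    then have "hit (build C Emp) f" using 0(1) by (simp add: force_def all_hit_iff)
    then obtain f0 where f0: "f0 \<in> stored (build C Emp)" "dominates f0 f" using hit_stored by blast
    then have "f0 \<in> set C" using stored_build[of C Emp] by auto
    with 0(2) f0(2) show "\<exists>e'\<in>realized 0. dominates e' f"
      unfolding supports_def using dominates_trans by blast
  qed
next
  case (Suc m)
  then show ?case using supports_next_elems[OF Suc.prems(2) child_zero] by (simp add: force_def)
qed

section \<open>Exact states and exact runs\<close>

definition exact :: "nat \<Rightarrow> elem list \<Rightarrow> bool" where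
  "exact n C \<longleftrightarrow> covers n C \<and> supports n C"

lemma exact_complexity:
  "exact n C \<Longrightarrow> abelian_complexity fourbonacci_word n = length (remdups (balanced C))"
  using covers_upper supports_lower by (auto simp: exact_def intro: antisym)

text \<open>The computed successor list is supporting by construction, whereas covering is verified
  by \<open>upper_step\<close>. The argument \<open>l\<close> is the current letter, which decides
  whether a digit 1 may follow.\<close>

fun run_count :: "nat \<Rightarrow> nat list \<Rightarrow> elem list \<Rightarrow> nat \<Rightarrow> bool" where
  "run_count l [] C c = force (\<lambda>v. v = c) (length (remdups (balanced C)))"
| "run_count l (d # ds) C c = force (\<lambda>C'. if upper_step d C C' then
     (if d = 0 then run_count 0 ds C' c else if d = 1 then
       (if l < 3 then force (\<lambda>l'. run_count l' ds C' c) (l + 1) else False) else False) else False)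
     (next_elems d C [] [] Emp)"

fun append_digits :: "nat \<Rightarrow> nat list \<Rightarrow> nat" where
  "append_digits n [] = n"
| "append_digits n (d # ds) = append_digits (img n + d) ds"

lemma run_count_complexity:
  assumes "run_count l ds C c" "exact n C" "letter n = l"
  shows "abelian_complexity fourbonacci_word (append_digits n ds) = c"
  using assms
proof (induction ds arbitrary: l C n)
  case Nil
  then show ?case by (simp add: exact_complexity force_def)
next
  case (Cons d ds)
  let ?C = "next_elems d C [] [] Emp"
  have up: "upper_step d C ?C" and d: "d = 0 \<or> d = 1 \<and> l < 3"
    and run: "run_count (if d = 0 then 0 else l + 1) ds ?C c"
    using Cons.prems(1) by (auto simp: force_def split: if_splits)
  have ch: "child n d (img n + d)" using d Cons.prems(3) by (auto simp: child_def)
  have "exact (img n + d) ?C"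
    using covers_child[OF _ ch up] supports_next_elems[OF _ ch] Cons.prems(2) by (simp add: exact_def)
  moreover have "letter (img n + d) = (if d = 0 then 0 else l + 1)"
    using letter_child[OF ch] Cons.prems(3) by simp
  ultimately show ?case using Cons.IH[OF run] by simp
qed

subsection \<open>Transition tables\<close>

definition elem_table :: "elem list" where
  "elem_table = [
    ((0,0,0,0),0,0), ((1,1,0,0),0,0), ((1,0,1,0),0,0), ((1,0,0,1),0,0), ((-1,0,0,0),0,0),
    ((1,0,0,0),0,0), ((0,0,0,1),0,0), ((0,0,1,0),0,0), ((0,1,0,0),0,0), ((0,-1,0,1),0,0),
    ((0,0,-1,0),0,0), ((0,0,-1,1),0,0), ((2,0,0,0),0,1), ((0,-1,1,0),0,0), ((0,0,1,-1),0,0),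
    ((0,-1,0,0),0,0), ((0,1,-1,0),0,0), ((0,1,0,-1),0,0), ((0,0,0,-1),0,0), ((1,-1,0,0),0,1),
    ((1,1,-1,1),0,0), ((1,1,-1,0),0,0), ((0,1,0,1),1,0), ((-1,1,0,0),1,0), ((1,1,0,-1),0,0),
    ((0,1,1,0),1,0), ((-1,0,0,1),1,0), ((0,-1,1,1),0,0), ((1,-1,0,1),0,1), ((-1,0,1,-1),0,0),
    ((1,0,1,-1),0,0), ((1,0,-1,0),0,1), ((0,1,1,-1),0,0), ((1,-1,1,0),0,1), ((1,0,0,-1),0,1),
    ((-1,0,1,0),1,0), ((1,0,0,2),0,0), ((0,-1,0,0),0,1), ((0,1,-1,1),0,0), ((-1,1,-1,0),1,0),
    ((-1,0,1,0),0,0), ((1,0,-1,1),0,0), ((-1,0,0,1),0,0), ((-1,1,0,-1),1,0), ((0,2,0,0),1,0),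
    ((0,0,1,1),0,0), ((-1,1,1,-1),1,0), ((0,1,0,0),1,0), ((-1,1,0,-1),0,0), ((0,1,1,0),0,0),
    ((2,0,-1,1),0,1), ((0,1,0,1),0,0), ((-1,1,1,0),1,0), ((0,-1,1,-1),0,1), ((1,-1,-1,1),0,1),
    ((-1,1,0,1),1,0), ((0,1,1,-1),1,0), ((1,-1,1,1),0,0), ((-1,1,-1,0),0,0), ((-1,1,-1,1),1,0),
    ((0,0,1,1),1,0), ((1,-1,0,1),0,0), ((2,-1,0,1),0,1), ((0,-1,1,-1),0,0), ((1,0,2,-1),0,0),
    ((0,0,2,0),2,0), ((0,1,-1,1),1,0), ((1,-1,1,0),0,0), ((2,-1,1,0),0,1), ((0,1,-1,-1),0,0),
    ((1,0,1,-1),0,1), ((2,1,-1,0),0,2), ((-2,1,0,0),1,0), ((-1,1,0,0),0,0), ((1,-1,1,-1),0,1),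
    ((1,0,-1,1),0,1), ((1,-1,1,1),0,1), ((2,0,0,0),0,0), ((0,0,1,1),2,0), ((-1,-1,1,1),0,0),
    ((-1,-1,1,1),2,0), ((0,-1,0,1),0,1), ((0,2,1,-1),1,0), ((1,2,-1,0),0,0), ((-1,0,1,-1),1,0),
    ((0,-2,1,0),0,1), ((0,-1,0,2),0,0), ((1,0,0,0),0,1), ((-1,0,1,1),1,0), ((2,1,-1,0),0,1),
    ((0,-1,1,0),0,1), ((-1,0,0,0),1,0), ((0,0,0,-1),0,1), ((0,2,0,-1),1,0), ((0,0,-2,1),0,2),
    ((0,0,-1,0),0,1), ((0,2,-1,0),1,0), ((1,0,-1,0),0,2), ((1,0,-1,2),0,0), ((0,0,2,-1),0,0),
    ((1,0,-1,0),0,0), ((0,0,0,2),1,0), ((1,1,-1,-1),0,2), ((0,0,-1,2),0,0), ((0,0,0,2),0,0),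
    ((0,0,1,0),2,0), ((0,1,0,2),1,0), ((2,0,-1,0),0,1), ((2,1,-1,0),0,0), ((0,-1,-1,2),0,0),
    ((0,0,1,0),1,0), ((0,0,2,1),2,0), ((0,1,2,-1),1,0), ((1,-1,-1,0),0,1), ((1,-1,0,2),0,1),
    ((-1,0,1,1),2,0), ((1,0,0,-1),0,0), ((1,1,-1,0),0,2), ((1,2,-1,0),1,0), ((2,0,0,-1),0,1),
    ((-1,1,-1,1),0,0), ((0,0,-1,0),0,2), ((0,0,0,1),1,0), ((0,2,-1,1),1,0), ((1,-1,-1,2),0,1),
    ((-1,-1,0,2),3,0), ((-1,0,2,-1),2,0), ((0,-1,2,0),0,0), ((0,0,0,2),3,0), ((0,0,2,-1),2,0),
    ((0,0,2,0),0,0), ((1,-1,0,2),0,0), ((-1,0,-1,2),1,0), ((0,0,-1,1),0,2), ((1,0,-1,1),0,2),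
    ((2,-1,0,2),0,1), ((-2,1,1,-1),1,0), ((-1,-1,0,2),0,0), ((-1,0,0,2),1,0), ((-1,1,1,-1),0,0),
    ((0,-2,1,1),0,1), ((0,0,0,-2),0,3), ((0,1,-1,2),1,0), ((1,-1,0,-1),0,1), ((1,-1,0,0),0,0),
    ((2,-1,0,0),0,1), ((-1,-1,2,0),2,0), ((-1,0,1,0),2,0), ((0,0,0,-1),0,3), ((0,0,2,0),1,0),
    ((0,1,-1,0),1,0), ((1,-1,2,0),0,1), ((1,0,0,2),3,0), ((1,1,0,-1),0,2), ((-1,2,0,-1),1,0),
    ((0,0,-2,1),0,0), ((0,2,0,-1),0,0), ((1,0,0,1),0,1), ((-1,-1,1,1),1,0), ((-1,0,2,0),2,0),
    ((0,-1,-1,2),0,1), ((0,0,-1,1),0,1), ((0,0,1,2),2,0), ((1,0,-1,-1),0,1), ((1,0,0,-1),0,3),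
    ((1,0,1,0),0,1), ((1,1,-1,-1),0,0), ((-1,0,1,-1),2,0), ((0,0,-1,2),1,0), ((0,0,0,-2),0,1),
    ((0,0,0,1),2,0), ((0,1,0,-2),0,0), ((1,0,-2,1),0,2), ((-1,2,-1,0),1,0), ((0,-1,2,-1),0,0),
    ((0,0,0,1),3,0), ((0,1,1,-2),0,0), ((0,2,-1,0),0,0), ((1,0,-1,-1),0,2), ((1,1,-1,0),0,1),
    ((1,1,-1,1),0,2), ((1,1,0,-2),0,3), ((1,1,0,-1),0,1), ((-1,0,-1,2),0,0), ((-1,2,0,0),1,0),
    ((0,-1,1,1),2,0), ((0,0,1,-1),0,1), ((0,1,0,-1),1,0), ((0,1,2,-1),2,0), ((0,2,0,0),0,0),
    ((1,0,0,-1),0,2), ((1,1,0,-1),0,3), ((1,2,-1,-1),0,0), ((2,0,-1,1),0,0), ((2,1,-1,-1),0,2),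
    ((-1,-1,2,-1),0,0), ((-1,-1,2,0),0,0), ((-1,0,0,2),3,0), ((-1,0,1,1),0,0), ((-1,0,2,0),1,0),
    ((-1,1,1,-2),1,0), ((-1,1,1,1),1,0), ((0,0,0,-1),0,2), ((0,0,1,-2),0,1), ((0,1,0,-2),0,3),
    ((0,2,-1,-1),1,0), ((1,-1,2,-1),0,1), ((1,-1,2,0),0,0), ((1,0,-1,2),0,1), ((1,1,-1,-1),0,1),
    ((-2,0,1,1),1,0), ((-1,-1,2,-1),2,0), ((-1,0,2,-1),1,0), ((-1,1,-1,2),1,0), ((0,-1,0,2),0,1),
    ((0,-1,0,2),3,0), ((0,0,0,2),2,0), ((0,0,1,-2),0,0), ((0,0,1,2),3,0), ((0,0,2,-1),1,0),
    ((0,1,-2,0),0,0), ((0,1,-2,0),0,2), ((0,1,-1,-1),0,2), ((0,1,-1,2),0,0), ((1,-2,0,1),0,1),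
    ((1,0,0,2),1,0), ((1,1,-2,0),0,2), ((1,1,1,-2),0,3), ((-2,1,0,1),1,0), ((-2,1,1,0),1,0),
    ((-1,-1,0,2),1,0), ((-1,-1,0,2),2,0), ((-1,-1,1,2),2,0), ((-1,-1,2,1),2,0), ((-1,0,0,1),3,0),
    ((-1,0,2,-1),0,0), ((-1,1,0,1),0,0), ((-1,1,1,-2),0,0), ((-1,1,1,0),0,0), ((-1,1,2,-1),1,0),
    ((-1,2,1,-1),1,0), ((0,-2,0,2),0,1), ((0,-1,1,1),0,1), ((0,-1,1,2),0,0), ((0,-1,1,2),2,0),
    ((0,-1,2,1),0,0), ((0,-1,2,1),2,0), ((0,0,1,-2),0,3), ((0,0,1,2),1,0), ((0,1,-2,1),0,0),
    ((0,1,0,-1),0,2), ((0,1,2,-1),0,0), ((0,2,1,-1),0,0), ((1,-1,-1,1),0,0), ((1,-1,-1,2),0,0),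
    ((1,-1,1,-1),0,0), ((1,-1,1,2),0,0), ((1,-1,1,2),0,1), ((1,0,-2,0),0,2), ((1,0,1,-2),0,1),
    ((1,0,2,-1),0,1), ((1,1,-1,1),1,0), ((1,1,1,-2),0,0), ((2,-1,-1,1),0,1), ((2,-1,-1,2),0,1),
    ((2,-1,1,-1),0,1), ((2,1,-1,-1),0,1), ((-2,0,2,-1),2,0), ((-1,0,0,1),2,0), ((-1,0,0,2),2,0),
    ((-1,2,-1,-1),1,0), ((-1,2,-1,1),1,0), ((0,-2,1,0),0,0), ((0,-2,1,1),0,0), ((0,-1,2,-1),0,1),
    ((0,-1,2,0),0,1), ((0,-1,2,0),2,0), ((0,0,-2,1),0,1), ((0,0,0,-2),0,2), ((0,0,1,-1),2,0),
    ((0,0,2,1),1,0), ((0,1,0,-1),0,3), ((0,2,-1,-1),0,0), ((0,2,-1,1),0,0), ((1,-2,1,0),0,1),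
    ((1,-2,1,1),0,1), ((1,-1,2,-1),0,0), ((1,0,-2,1),0,1), ((1,1,-2,1),0,0), ((1,1,-2,1),0,2),
    ((1,1,-1,1),0,1), ((1,2,-1,-1),1,0), ((2,-1,2,-1),0,1), ((2,0,-1,0),0,2), ((2,1,-2,1),0,2),
    ((-2,0,1,1),2,0), ((-2,0,2,-1),1,0), ((-1,0,1,1),3,0), ((-1,0,2,1),2,0), ((0,0,-1,2),3,0),
    ((0,0,1,1),3,0), ((0,0,2,1),0,0), ((0,1,-2,1),0,2), ((0,1,-2,1),1,0), ((0,1,-1,-1),0,1),
    ((0,1,-1,0),0,2), ((0,1,0,-2),0,2), ((0,1,1,-2),0,3), ((0,1,1,-2),1,0), ((0,1,1,-1),2,0),
    ((0,1,1,0),2,0), ((0,2,-1,2),1,0), ((0,2,1,-2),1,0), ((1,0,-1,2),0,2), ((1,0,0,2),0,1),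
    ((1,0,1,-2),0,3), ((1,1,0,-2),0,2), ((1,1,0,-1),1,0), ((1,1,1,-2),0,1), ((1,2,-1,-1),0,2),
    ((2,-1,0,2),0,0), ((2,0,-1,1),0,2)]"

fun select :: "num \<Rightarrow> elem list \<Rightarrow> elem list" where
  "select n [] = []"
| "select num.One (e # T) = [e]"
| "select (num.Bit0 n) (e # T) = select n T"
| "select (num.Bit1 n) (e # T) = e # select n T"

text \<open>The binary digits of \<open>k\<close>, least significant first, select entries of \<^const>\<open>elem_table\<close>.\<close>

definition members :: "nat \<Rightarrow> elem list" where
  "members k = select (num_of_nat k) elem_table"

text \<open>A row \<open>(m, t0, t1, k)\<close> describes a state with element set \<open>members k\<close> for numbers whose letter
  is at least \<open>m\<close>; the states after the digits \<open>0\<close> and \<open>1\<close> have the indices \<open>t0\<close> and \<open>t1\<close>.\<close>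

type_synonym row = "nat \<times> nat \<times> nat \<times> nat"

definition cover_rows :: "row list" where
  "cover_rows = [
    (0,35,85,42888374607303543054216688525889224703),
    (0,49,102,3657344841336422596115917059846361708944621311),
    (0,6,74,845892186497956426291774984897649865282056975507810026326628169727),
    (0,23,10,115823894209918793039144431222757406870300613658073605764280501477731194158847),
    (0,42,86,463168356949264781706838149678959289943422869475424182252427787870508140187519),
    (0,56,89,215679587799650681201745828047671988836487797301563311055391129301503),
    (0,17,10,105312294807108054391263990253983261765637809757103878542737522687),
    (0,48,71,395387590987590903456959880988493416036761675522804545535),
    (0,16,91,23385453445029708718728255759736238859051702484991),
    (0,59,89,2787678225606069317388136535183304380381183),
    (0,50,77,392318858461667548090653035017871845812035881111342022655),
    (0,23,96,397895249451169805845932944559009801635240351678207),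
    (0,52,72,14835861433585110088137918375320826872385846043440158947845563444188977703481087),
    (0,62,95,3705346855594118253555840795712225098345048694493821474855460730670984456892159),
    (0,54,86,2085924839766513752338888494455986572216177988020877090024231495651298068016145173482164968831),
    (0,16,91,23387684982253297817815884626955322015690989043711),
    (0,22,98,6547573007168973559410621793260190727490369411346303),
    (0,10,102,59343445734124550154605287263856641114018475703125573860602337729128594731953919),
    (0,38,99,2135987035920910126902606006789924677217506734720757995158063413911172987501714087051080683073151),
    (0,39,74,3657322470434446308209285994998437327638819839),
    (0,35,100,29671722870513148250685346802193654680977778693352608129190866411714954823057407),
    (0,4,100,115823894209918793039144431246141076250206097681199519022162546665634318319359),
    (0,10,86,25111475779300764287997435096740565941190345488235593985535),
    (0,7,86,3978586010312560900811092267780351737768725899398632783918394988976147980038730936209407),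
    (0,48,71,133499189745056888486719281722573703875163666364882263842500183852371651962459930888671448786367),
    (0,46,86,25108407046774852093892441823190557542611770717910553587711),
    (0,17,7,3450873173398420444585071277101083059826725278468355164636069786001407),
    (0,53,84,8081502591659146013237953344013465154798377220957359198112938551648039428799668538500863),
    (0,35,75,42556067587931230241245592933558632447),
    (0,64,74,196159429234491118711204842071355492562972833659025686527),
    (0,26,74,226156424298523794737282458733692470674897557856069576956710320138445846271),
    (0,48,71,485675560086857354706562164092437889432610483858829602634779418613924717829829945023),
    (0,25,85,5708990770834712163452023679539431083375325183),
    (0,57,84,66749602985242798709059127451153892854946372440128087861771869859356167947393658475422234765039),
    (0,10,86,25108407046774843730762065310571515145209434396240314888191),
    (0,10,86,3978586009849392516254842098911258438537820900510958806327324552150924108493335669239743),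
    (0,45,86,874180573178813168963575531184790809992412890456093177222225407),
    (0,0,74,2809456297084087369270087334898734189178879),
    (0,5,86,118571099379121308948500285717406015984939147779497253218962584400459362727873855),
    (0,17,10,374144775968698147915007898714165318514598431277055),
    (0,4,96,15914343565113172548972231940699836158648816075649914343163574401281223171313094205173375),
    (0,62,95,62180581767880816199854154640376366601055764753999450001131166765390122044028837228287),
    (0,48,71,3068732525923345508752034409857962194320460709863880191),
    (0,24,108,1051092660152084972821207072774417891674800335505192028605404668140433411118524915540533119),
    (0,46,105,105312291668557373781551168233018990738326055233724537596978356223),
    (0,59,89,85075784819375097021600076914840500223),
    (0,48,71,25108407046774854881815561616734417088110561874747064315903),
    (0,36,72,14835861433531137538657832240119342528208518090672746401102574118010406818868783),
    (0,32,106,340614673920818625444139782496768229375),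
    (0,35,108,374144419157073030031371444741596570092227579060223),
    (0,51,91,5711779044538389694004181980107075811459198975),
    (0,34,85,340614673940331330378436107643943649279),
    (0,9,86,874180573178813168963575531185278874659153515789328572269715455),
    (0,35,76,105312294807114040747642423798594633314299288784957994042996269055),
    (0,48,71,215679587799647612469219907480143404565157982693734295219115561842175),
    (0,25,75,196159429230833773912424487063190150261080613409934671871),
    (0,32,106,23384026197337002759005653795984500477427170738175),
    (0,31,76,994889306432006126251426057438847850606310669554233381332947198327119553867680937910271),
    (0,22,80,971334446112864535459730953411765439683290843841849449350493532576653759866631859839),
    (0,32,48,11417981584203746641349392708109592730651066367),
    (0,51,91,1427270151342176663036941986097600109933948927),
    (0,43,95,16007735858102312356593045188027482838657662704207402816968982414294609951586885843611391),
    (0,24,108,16328862482661192883565692309310348891582206742288740271398341861468006717037776192101388159),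
    (0,25,75,3450873179823034070753339033358105283672151034088574289148204082135039),
    (0,34,98,374144597563034618276355340069556847257209903497215),
    (0,23,80,971364117835731597734808243672833719329222184128168376781302161324272688786713718399),
    (0,20,74,226156424298318106667617307981280382508298080966069580702476229952062551039),
    (0,44,109,523518246403638484257847897473662931042481652936442786808814821900746872677126295192078837439),
    (0,25,102,59343445734178522704060265758259121061348123897162964876778749020897446605614847),
    (2,63,81,254629588104415083864821596571721148844954462071735612944957613282410437553029094529037311),
    (2,3,82,127314778875110440860220757937756210331386799407889263631826560693947026613575887630787551),
    (1,61,83,1989292945646385894480134114942831483010264240849426444921228579061825826160301050118623),
    (1,30,70,1068026110543848965681384128691384268100450863825397218504573772032266408538793984463990621949403),
    (2,18,93,4583330946754678474717710905537310210862045171844734358596617214577249734359128834428171263),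
    (1,68,78,7067401778990359560269420956946366804275028707246891371482298834824137183),
    (1,60,79,350957734423691623695697938366298808319),
    (1,8,89,221071562709201759474266261630697089665093926472214926503430453539074559),
    (1,13,101,421249166681891228149756434150960514732301714668890251506535846399),
    (2,28,104,21863147267759437740930961378553650675711),
    (2,21,104,237145818199449737522097045112184048265463164607796039595825166460185270324261887),
    (1,19,70,899891581886770055164078034611088795263780021173986710173212159),
    (3,94,0,16687398718132110018711107079451275015613422055126097394485493587416446738392003338404521640927),
    (3,47,0,232050633001480642476867338259626782060097491416858407647224600671824194382815),
    (2,65,107,1942668892282281980906319380924165078934337780502140424156161578753528450034119015423),
    (1,33,110,4179997842869797215255412609339038549939700651402473783673245717632089125387837543135285676511),
    (1,1,88,6739986667186108789406064690356559276375396735569450423221189041663),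
    (1,41,73,33635538041235271409522210518257812713048875343521821487670217708287901299353820051203550302719),
    (3,68,0,5857425053538998409177936275312614142683316486143),
    (2,11,90,60708402882054033887483255165113608317696094698861142069473298927223358745275950047),
    (1,61,92,1809693968845530691580838199581573058396919202207226085695921901461093548511),
    (3,17,0,13493137370046149515844038291780431826133229643836050083472921930719),
    (1,68,103,7067388259525114324919025360220058619542080123510980898452961467661770751),
    (2,58,107,6427752177035961103561687502936709482174732148533324802490367),
    (3,17,0,5846369510850991566844941557177454710289199644671),
    (0,14,72,266998379490113764004724568946244764026896166673831373641715089681876445164161172623292992122479),
    (1,67,69,1042963414772563308175570344371543628254699175857201436033175296963548783205622496025327640575),
    (1,2,70,203534678379472254070348862316475457599317506637913599),
    (2,40,48,26328073016751515600130225307261991540596541087438234934665356255),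
    (1,29,88,25711401793250190688978978911805115925380426005260535707687423),
    (1,66,70,7773046990890496522730964164025557546186385603445209372446277384576392092738502745599),
    (1,37,79,874180573178626096575591564980745036337136834431506613123112447),
    (2,68,87,6588175873565745489502624560403313550230969089023),
    (1,27,110,15545145420224733375584773671537422745478966720316432766456732045324635780265888927199),
    (2,55,87,21863316017288811576407887502744088476671),
    (3,12,0,232050633001480231103952378575367317083298521818142070427491936362903977012191),
    (1,8,97,1852673427797059126777135760139006525663294073873364536624562629964371526644735),
    (1,68,101,392318858473085529621669481073579986055814024918650290175),
    (3,17,0,26328072917139489604119719467551992831769107341194468443462795263),
    (1,15,73,542470828641778984570305809259113278731332413259516478635148287244543012039279551213380445884927),
    (1,33,110,65646668154662441158871856978513488503330995776448124131229636971926753507138859983503835),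
    (2,20,90,1942668892508438404783382797068026499840409547412331479962889573335826372583314355199)]"

text \<open>By \<open>support_rows_ok\<close> each state has at least 7 balanced deviations and the
  table is closed under children, so a number that enters it never leads back to complexity 4 or
  6.\<close>

definition support_rows :: "row list" where
  "support_rows = [
    (0,2,21,356822814870687433105894188536939083693298175),
    (0,13,22,23384026219077836384417305638537852579305170447919),
    (0,13,22,23384026219077836384414829607343554366926725365311),
    (0,6,22,1284484836402829051081471),
    (0,12,22,1569275433846670190964265565861766143014557318454700732975),
    (0,0,23,47890485652059029482154337425561760275987839320478143),
    (0,15,24,5316952550434753308516338202186456623),
    (0,16,22,5709012548896620696967048754045066784524516991),
    (0,18,22,4271974071841820164790043412339104229205458084570618957328326824799050781101790121134301437804079),
    (0,13,22,49039880691734662545303489286154067373935949495877287471),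
    (0,0,25,47890485652059026824996579764647687869998695248229423),
    (0,6,22,365376803129300637717382120317197788381369119471),
    (0,10,24,40564821967527126546918736469375),
    (0,5,24,1496577676626844588281138087948991055065758893022527),
    (0,20,22,7136238468848009465121609559330098072513986095),
    (0,0,26,47890485652059026823743982515281221491400923494700079),
    (0,5,24,1496577676626844588281140563791290713246449010711599),
    (0,19,22,1618315291154378634431731372656400089259388950290293912239),
    (0,5,24,1496577676626844920593210731389420594049001155140655),
    (0,10,24,332347584191446920353164011213234047),
    (0,5,24,1683649886205200161816282824818257137956946166897711),
    (1,2,27,356822814870687433260636693447629210241728991),
    (1,4,29,474284397516047136454946756128131085354662594365293002575067884074910161169351123),
    (1,9,27,46950740110144333527139669475022585824331125752275),
    (1,3,30,27606985387162255149785985785594860301975767973845604512446835692028371),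
    (1,17,28,65185155128041339212048403868023914802217347296732900901426733981668197863286219609915523539),
    (1,11,28,1809251394333065553591376402326906330408148891648876542490172093715154207187),
    (2,2,31,356822814870687433260636730341099765474787807), (2,14,31,156027026640422910791001055),
    (2,7,31,6427752177036143789872514732229427266096746294880962810495447),
    (2,8,31,7067388259113537318333190185659378729675396513097537241339378074459832791),
    (3,1,0,11231976564383934528664459845334447686111)]"

text \<open>The entries \<open>0, \<dots>, 8\<close> belong to the prefixes of \<open>10001000\<dots>\<close> of these lengths, after which
  \<open>5, \<dots>, 8\<close> repeat cyclically; \<open>9, 10, 11\<close> belong to \<open>n = 3, 6, 12\<close>.\<close>

definition special_masks :: "nat list" where
  "special_masks = [
    47890486008870952658684871252057703499062271654498367,
    27606985387162255149785974367613318654296714550960807904533562370556371,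
    5318210059830177277093262161349227055, 1496577676626844588281140563829069625958232881175599,
    47890485652059029482194903482709102902356711808847919,
    46950740099255297785668398286303673776981294449107,
    49039857307708443472785314928678757228904084180702900783,
    1496577676626844920588159936028545946708240732593199,
    47890485654846622632011231375401067686437756997095471,
    182687704666362864776856006753719051501227213271,
    5709012554213532682581307839394793527133650479,
    1496577676626844588281140563829069625967046171237423]"

section \<open>Checkers for the tables\<close>

fun holds_at :: "nat \<Rightarrow> 'a list \<Rightarrow> ('a \<Rightarrow> bool) \<Rightarrow> bool" where
  "holds_at n [] f = False"
| "holds_at 0 (r # R) f = f r"
| "holds_at (Suc n) (r # R) f = holds_at n R f"

lemma holds_at_imp_ex: "holds_at n R f \<Longrightarrow> \<exists>r\<in>set R. f r"
  by (induction n R f rule: holds_at.induct) auto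

fun row_step_ok :: "(elem list \<Rightarrow> bool) \<Rightarrow> nat \<Rightarrow> row \<Rightarrow> bool" where
  "row_step_ok f m (m', t0, t1, k) = (if m' \<le> m then force f (members k) else False)"

definition num_balanced :: "elem list \<Rightarrow> nat" where
  "num_balanced C = length (remdups (balanced C))"

text \<open>One checker for both tables: \<open>f\<close> is \<open>upper_step\<close> or
  \<open>lower_step\<close>, and \<open>p\<close> bounds the number of balanced vectors. The digit 0
  resets the lower bound on the letter to 0, the digit 1 raises it to \<open>m + 1\<close>.\<close>

fun row_ok_for :: "(nat \<Rightarrow> elem list \<Rightarrow> elem list \<Rightarrow> bool) \<Rightarrow> (nat \<Rightarrow> bool) \<Rightarrow> row list \<Rightarrow> row \<Rightarrow> bool" where
  "row_ok_for f p R (m, t0, t1, k) = force (\<lambda>C.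
     if force p (num_balanced C) then
       if holds_at t0 R (row_step_ok (f 0 C) 0) then
         if m < 3 then force (\<lambda>m'. holds_at t1 R (row_step_ok (f 1 C) m')) (m + 1) else True
       else False
     else False) (members k)"

fun rows_ok :: "(nat \<Rightarrow> elem list \<Rightarrow> elem list \<Rightarrow> bool) \<Rightarrow> (nat \<Rightarrow> bool) \<Rightarrow> row list \<Rightarrow> row list \<Rightarrow> bool" where
  "rows_ok f p R [] = True"
| "rows_ok f p R (r # rs) = (if row_ok_for f p R r then rows_ok f p R rs else False)"

lemma rows_ok_iff: "rows_ok f p R rs \<longleftrightarrow> (\<forall>r\<in>set rs. row_ok_for f p R r)"
  by (induction rs) auto

definition special :: "nat \<Rightarrow> elem list" where
  "special j = members (special_masks ! j)"

fun special_steps_ok :: "(nat \<times> nat \<times> nat) list \<Rightarrow> bool" where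
  "special_steps_ok [] = True"
| "special_steps_ok ((j, d, j') # r) = force (\<lambda>C. force (\<lambda>C'. if upper_step d C C' then
     if lower_step d C C' then special_steps_ok r else False else False) (special j')) (special j)"

fun special_exits_ok :: "row list \<Rightarrow> (nat \<times> nat \<times> nat \<times> nat) list \<Rightarrow> bool" where
  "special_exits_ok R [] = True"
| "special_exits_ok R ((j, d, m, g) # r) = force (\<lambda>C.
     if holds_at g R (row_step_ok (lower_step d C) m) then special_exits_ok R r else False) (special j)"

fun special_counts_ok :: "(nat \<times> nat) list \<Rightarrow> bool" where
  "special_counts_ok [] = True"
| "special_counts_ok ((j, v) # r) =
     force (\<lambda>C. if force (\<lambda>u. u = v) (num_balanced C) then special_counts_ok r else False) (special j)"

fun runs_ok :: "elem list \<Rightarrow> (nat \<times> nat list) list \<Rightarrow> bool" where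
  "runs_ok C [] = True"
| "runs_ok C ((c, ds) # r) = (if run_count 0 ds C c then runs_ok C r else False)"

lemma special_steps_ok_iff:
  "special_steps_ok r \<longleftrightarrow>
     (\<forall>(j, d, j')\<in>set r. upper_step d (special j) (special j') \<and> lower_step d (special j) (special j'))"
  by (induction r rule: special_steps_ok.induct) (auto simp: force_def)

lemma special_exits_ok_iff:
  "special_exits_ok R r \<longleftrightarrow>
     (\<forall>(j, d, m, g)\<in>set r. holds_at g R (row_step_ok (lower_step d (special j)) m))"
  by (induction R r rule: special_exits_ok.induct) (auto simp: force_def)

lemma special_counts_ok_iff:
  "special_counts_ok r \<longleftrightarrow> (\<forall>(j, v)\<in>set r. num_balanced (special j) = v)"
  by (induction r rule: special_counts_ok.induct) (auto simp: force_def)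

lemma runs_ok_iff: "runs_ok C r \<longleftrightarrow> (\<forall>(c, ds)\<in>set r. run_count 0 ds C c)"
  by (induction C r rule: runs_ok.induct) auto

subsection \<open>Evaluation by rewriting\<close>

lemma force_cong: "x = y \<Longrightarrow> force f x = force f y"
  by simp

lemma holds_at_cong: "n = n' \<Longrightarrow> holds_at n R f = holds_at n' R f"
  by simp

text \<open>As congruence rules these reflexive equations forbid rewriting inside arguments; with
  \<open>force_cong\<close> they fix the evaluation order.\<close>

lemma no_argument_congs:
  "build C t = build C t" "succs_hit d C A t = succs_hit d C A t"
  "build_succs d C A t = build_succs d C A t" "all_hit C t = all_hit C t"
  "next_elems d C A B t = next_elems d C A B t" "run_count a ds C c = run_count a ds C c"
  "ins e t = ins e t" "hit t e = hit t e" "lookup ks t = lookup ks t" "put ks p t = put ks p t"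
  "succs d e = succs d e" "succs_at l x y z a c = succs_at l x y z a c"
  "select n C = select n C" "members m = members m" "num_balanced C = num_balanced C"
  "row_step_ok f m r = row_step_ok f m r" "row_ok_for g q R r = row_ok_for g q R r"
  "rows_ok g q R R' = rows_ok g q R R'"
  "special m = special m" "special_steps_ok js = special_steps_ok js"
  "special_exits_ok R js' = special_exits_ok R js'" "special_counts_ok vs = special_counts_ok vs"
  "runs_ok C ws = runs_ok C ws"
  "upper_step d C A = upper_step d C A" "lower_step d C A = lower_step d C A"
  by (rule refl)+

lemma members_numeral: "members (numeral n) = force (select n) elem_table"
  by (simp add: members_def force_def num_of_nat_numeral_eq)

lemma holds_at_numeral: "holds_at (numeral n) (r # R) f = holds_at (pred_numeral n) R f"
  "holds_at 1 (r # R) f = holds_at 0 R f"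
  by (simp_all add: numeral_eq_Suc)

lemma nth_cong: "n = n' \<Longrightarrow> xs ! n = xs ! n'"
  by simp

lemma nth_eval: "(x # xs) ! 0 = x" "(x # xs) ! 1 = xs ! 0" "(x # xs) ! numeral n = xs ! pred_numeral n"
  by (simp_all add: numeral_eq_Suc)

lemma special_eval: "special j = force members (force (\<lambda>xs. xs ! j) special_masks)"
  by (simp add: special_def force_def)

lemma iterates_hit_cong: "m = m' \<Longrightarrow> iterates_hit m C C' = iterates_hit m' C C'"
  by simp

lemma iterates_hit_eval:
  "iterates_hit (numeral m) C C' = force (\<lambda>B. iterates_hit (pred_numeral m) B C') (next_elems 0 C [] [] Emp)"
  "iterates_hit 1 C C' = force (\<lambda>B. iterates_hit 0 B C') (next_elems 0 C [] [] Emp)"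
  by (simp_all add: numeral_eq_Suc)

lemma keep_eval: "keep (x, y, z, w) =
    force (\<lambda>v. if -16 \<le> v then v \<le> 32 else False) (15 * x + 14 * y + 12 * z + 8 * w)"
  by (simp add: keep_def potential_def force_def)

lemma succs_eval:
  "succs d ((x, y, z, w), a, c) = force (\<lambda>l. succs_at l x y z a c) (x + y + z + w - int d)"
  by (simp add: force_def)

lemma succs_at_eval:
  "succs_at l x y z a c =
     (if a < 3 then
        if c < 3 then
          [((l, x, y, z), 0, 0), ((l - 1, x, y, z), a + 1, 0), ((l + 1, x, y, z), 0, c + 1),
           ((l, x, y, z), a + 1, c + 1)]
        else [((l, x, y, z), 0, 0), ((l - 1, x, y, z), a + 1, 0)]
      else if c < 3 then [((l, x, y, z), 0, 0), ((l + 1, x, y, z), 0, c + 1)]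
      else [((l, x, y, z), 0, 0)])"
  by (simp add: succs_at_def)

text \<open>One ground rule per index, with out-of-range values up to 6 in absolute value, so that
  no index comparison has to be rewritten.\<close>

lemma lookup_eval:
  "lookup (k # ks) Emp = []" "lookup [] Emp = []" "lookup (k # ks) (Leaf x) = []" "lookup [] (Leaf x) = x"
  "lookup (-2 # ks) (Node a b c d e) = lookup ks a" "lookup (-1 # ks) (Node a b c d e) = lookup ks b"
  "lookup (0 # ks) (Node a b c d e) = lookup ks c" "lookup (1 # ks) (Node a b c d e) = lookup ks d"
  "lookup (2 # ks) (Node a b c d e) = lookup ks e"
  "lookup (-3 # ks) t = []" "lookup (-4 # ks) t = []" "lookup (-5 # ks) t = []" "lookup (-6 # ks) t = []"
  "lookup (3 # ks) t = []" "lookup (4 # ks) t = []" "lookup (5 # ks) t = []" "lookup (6 # ks) t = []"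
  by (cases t; simp)+

lemma put_eval:
  "put [] p Emp = Leaf [p]" "put [] p (Leaf x) = Leaf (p # x)"
  "put (k # ks) p Emp = put (k # ks) p (Node Emp Emp Emp Emp Emp)"
  "put (-2 # ks) p (Node a b c d e) = Node (put ks p a) b c d e"
  "put (-1 # ks) p (Node a b c d e) = Node a (put ks p b) c d e"
  "put (0 # ks) p (Node a b c d e) = Node a b (put ks p c) d e"
  "put (1 # ks) p (Node a b c d e) = Node a b c (put ks p d) e"
  "put (2 # ks) p (Node a b c d e) = Node a b c d (put ks p e)"
  "put (-3 # ks) p (Node a b c d e) = Node a b c d e" "put (-4 # ks) p (Node a b c d e) = Node a b c d e"
  "put (-5 # ks) p (Node a b c d e) = Node a b c d e" "put (-6 # ks) p (Node a b c d e) = Node a b c d e"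
  "put (3 # ks) p (Node a b c d e) = Node a b c d e" "put (4 # ks) p (Node a b c d e) = Node a b c d e"
  "put (5 # ks) p (Node a b c d e) = Node a b c d e" "put (6 # ks) p (Node a b c d e) = Node a b c d e"
  by (simp_all add: Emp_def change_def)

lemma num_balanced_eval: "num_balanced C = force length (force remdups (balanced C))"
  by (simp add: num_balanced_def force_def)

lemma balanced_eval:
  "balanced [] = []"
  "balanced ((s, a, c) # C) = (if len s = 0 then s # balanced C else balanced C)"
  by (simp_all add: balanced_def)

lemma run_count_Nil: "run_count l [] C c = force (\<lambda>v. v = c) (num_balanced C)"
  by (simp add: num_balanced_def)

lemma member_eval: "x \<in> set [] \<longleftrightarrow> False" "x \<in> set (y # ys) \<longleftrightarrow> (if x = y then True else x \<in> set ys)"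
  by auto

lemma length_eval: "length [] = 0" "length (x # xs) = length xs + 1"
  by simp_all

lemma Pair_eq_eval: "(a, b) = (c, d) \<longleftrightarrow> (if a = c then b = d else False)"
  by simp

lemmas eval_simps =
  build.simps succs_hit.simps build_succs.simps all_hit.simps next_elems.simps run_count_Nil
  run_count.simps(2) ins.simps hit.simps any_le.simps lookup_eval put_eval succs_eval succs_at_eval
  keep_eval select.simps members_numeral elem_table_def num_balanced_eval balanced_eval len.simps
  remdups.simps member_eval Pair_eq_eval row_step_ok.simps row_ok_for.simps rows_ok.simps
  special_eval special_masks_def nth_eval special_steps_ok.simps special_exits_ok.simps
  special_counts_ok.simps runs_ok.simps iterates_hit.simps(1) iterates_hit_eval
  upper_step_def lower_step_def holds_at.simps(1,2) holds_at_numeral pred_numeral_simps BitM.simps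
  length_eval fst_conv force_def if_True if_False simp_thms list.distinct
  arith_simps rel_simps zero_le_one not_one_le_zero zero_neq_one one_neq_zero order_refl
  add_neg_numeral_special diff_numeral_special neg_equal_0_iff_equal zero_less_one
  of_nat_0 of_nat_1 add_0_left add_0_right diff_0 diff_0_right minus_zero less_irrefl
  numeral_less_iff numeral_le_iff inc.simps numeral_One add_num_simps mult_num_simps le_num_simps
  less_num_simps eq_num_simps one_add_one numeral_plus_one one_plus_numeral
  mult_zero_right mult_1_right mult_minus1_right

lemmas eval_congs = force_cong nth_cong holds_at_cong iterates_hit_cong no_argument_congs if_weak_cong

section \<open>The certified computations\<close>

definition special_steps :: "(nat \<times> nat \<times> nat) list" where
  "special_steps = [(0, 0, 0), (0, 1, 1), (1, 0, 2), (2, 0, 3), (3, 0, 4), (4, 1, 5), (5, 0, 6), (6, 0, 7), (7, 0, 8), (8, 1, 5), (1, 1, 9), (9, 0, 10), (10, 0, 11)]"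

text \<open>Together with \<open>special_steps\<close> this treats every admissible digit at each of
  the states 0 to 11. An entry \<open>(j, d, m, g)\<close> leads from state \<open>j\<close> under
  the digit \<open>d\<close> to row \<open>g\<close> of \<open>support_rows\<close>, for children
  whose letter is at least \<open>m\<close>.\<close>

definition special_exits :: "(nat \<times> nat \<times> nat \<times> nat) list" where
  "special_exits = [(2, 1, 1, 22), (3, 1, 1, 24), (4, 0, 0, 0), (5, 1, 2, 28), (6, 1, 1, 22), (7, 1, 1, 24), (8, 0, 0, 0), (9, 1, 3, 31), (10, 1, 1, 22), (11, 0, 0, 5), (11, 1, 1, 24)]"

text \<open>Appending \<open>ds\<close> to the digits of a number in the special state \<open>6\<close> yields complexity \<open>c\<close>.\<close>

definition complexity_words :: "(nat \<times> nat list) list" where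
  "complexity_words = [
    (7, [1]), (8, [1, 0]), (9, [1, 0, 0]), (10, [1, 1]), (11, [1, 0, 0, 0, 0]),
    (12, [1, 1, 1, 0, 1, 1]), (13, [1, 0, 1, 0, 1, 1, 0]), (14, [1, 1, 0, 1, 0, 0, 0, 0, 0]),
    (15, [1, 1, 1, 0, 1, 0, 1, 1, 0, 0, 0]), (16, [1, 0, 1, 0, 1, 0, 1, 0, 1, 0, 1, 1, 0])]"

lemma cover_rows_ok: "rows_ok upper_step (\<lambda>v. v \<le> 16) cover_rows cover_rows"
  unfolding cover_rows_def by (simp only: eval_simps cong: eval_congs)

lemma support_rows_ok: "rows_ok lower_step (\<lambda>v. 7 \<le> v) support_rows support_rows"
  unfolding support_rows_def by (simp only: eval_simps cong: eval_congs)

lemma special_steps_ok: "special_steps_ok special_steps"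
  unfolding special_steps_def by (simp only: eval_simps cong: eval_congs)

lemma special_exits_ok: "special_exits_ok support_rows special_exits"
  unfolding special_exits_def support_rows_def by (simp only: eval_simps cong: eval_congs)

lemma special_counts_ok:
  "special_counts_ok [(1, 4), (2, 4), (3, 4), (4, 4), (5, 4), (6, 4), (7, 4), (8, 4), (9, 6), (10, 6), (11, 6)]"
  by (simp only: eval_simps cong: eval_congs)

text \<open>The lower half of exactness at 0: six rounds suffice to generate every listed deviation
  from the pair of empty prefixes.\<close>

lemma special_zero_hit: "force (iterates_hit 6 [((0, 0, 0, 0), 0, 0)]) (special 0)"
  by (simp only: eval_simps cong: eval_congs)

lemma zero_in_special_zero: "((0, 0, 0, 0), 0, 0) \<in> set (special 0)"
  by (simp only: eval_simps cong: eval_congs)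

lemma cover_start: "force (\<lambda>C. holds_at 0 cover_rows (row_step_ok (upper_step 0 C) 0)) (special 0)"
  unfolding cover_rows_def by (simp only: eval_simps cong: eval_congs)

lemma complexity_words_ok: "force (\<lambda>C. runs_ok C complexity_words) (special 6)"
  unfolding complexity_words_def by (simp only: eval_simps cong: eval_congs)

subsection \<open>The exceptional orbit and the bounds\<close>

lemma row_step_okE:
  assumes "holds_at t R (row_step_ok f m)"
  obtains m' t0 t1 k where "(m', t0, t1, k) \<in> set R" "m' \<le> m" "f (members k)"
proof -
  obtain r where r: "r \<in> set R" "row_step_ok f m r" using holds_at_imp_ex[OF assms] by blast
  obtain m' t0 t1 k where "r = (m', t0, t1, k)" by (cases r) auto
  with r show thesis by (intro that) (auto simp: force_def split: if_splits)
qed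

text \<open>The invariant \<open>I\<close> is abstract so that the same step serves
  \<open>covers\<close> and \<open>supports\<close>.\<close>

lemma rows_ok_child:
  assumes ok: "rows_ok f p R R"
    and I: "\<And>n d n' C C'. I n C \<Longrightarrow> child n d n' \<Longrightarrow> f d C C' \<Longrightarrow> I n' C'"
    and row: "(m, t0, t1, k) \<in> set R" "m \<le> letter n" "I n (members k)" and ch: "child n d n'"
  shows "\<exists>m t0 t1 k. (m, t0, t1, k) \<in> set R \<and> m \<le> letter n' \<and> I n' (members k)"
proof -
  have r: "holds_at t0 R (row_step_ok (f 0 (members k)) 0)"
      "m < 3 \<Longrightarrow> holds_at t1 R (row_step_ok (f 1 (members k)) (m + 1))"
    using ok row(1) by (auto simp: rows_ok_iff force_def split: if_splits)
  \<comment> \<open>The digit 1 requires \<open>letter n < 3\<close>, and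
    \<open>m \<le> letter n\<close> then yields \<open>m < 3\<close>.\<close>
  have "\<exists>t. holds_at t R (row_step_ok (f d (members k)) (if d = 0 then 0 else m + 1))"
    using child_digit[OF ch] row(2) r by fastforce
  then obtain t where "holds_at t R (row_step_ok (f d (members k)) (if d = 0 then 0 else m + 1))" ..
  then obtain m' t0' t1' k' where row': "(m', t0', t1', k') \<in> set R"
      "m' \<le> (if d = 0 then 0 else m + 1)" "f d (members k) (members k')" by (rule row_step_okE)
  moreover have "m' \<le> letter n'"
    using row'(2) row(2) letter_child[OF ch] by (auto split: if_splits)
  ultimately show ?thesis using I[OF row(3) ch] by blast
qed

lemma rows_ok_count: "rows_ok f p R R \<Longrightarrow> (m, t0, t1, k) \<in> set R \<Longrightarrow> p (num_balanced (members k))"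
  by (auto simp: rows_ok_iff force_def split: if_splits)

section \<open>The numbers written with the prefixes of 10001000..\<close>

primrec spec :: "nat \<Rightarrow> nat" where
  "spec 0 = 0"
| "spec (Suc k) = img (spec k) + (if k mod 4 = 0 then 1 else 0)"

lemma letter_zero: "letter 0 = 0"
  using letter_img[of 0] by simp

text \<open>The two facts need each other: a digit 1 is admissible because the letter is small, and
  the letter is read off from the preceding child relation.\<close>

lemma letter_spec_aux:
  "letter (spec k) = (if k mod 4 = 1 then 1 else 0) \<and>
   child (spec k) (if k mod 4 = 0 then 1 else 0) (spec (Suc k))"
proof (induction k)
  case 0
  show ?case by (simp add: letter_zero child_def)
next
  case (Suc k)
  have "letter (spec (Suc k)) = (if k mod 4 = 0 then 1 + letter (spec k) else 0)"
    using letter_child[OF conjunct2[OF Suc]] by (simp del: spec.simps)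
  then have *: "letter (spec (Suc k)) = (if Suc k mod 4 = 1 then 1 else 0)"
    using conjunct1[OF Suc] by (cases "k mod 4 = 0"; simp del: spec.simps; presburger)
  then have "letter (spec (Suc k)) < 3" by simp
  then have "child (spec (Suc k)) (if Suc k mod 4 = 0 then 1 else 0) (spec (Suc (Suc k)))"
    unfolding child_def spec.simps(2)[of "Suc k"] by simp
  with * show ?case by blast
qed

lemmas letter_spec = conjunct1[OF letter_spec_aux]
lemmas child_spec = conjunct2[OF letter_spec_aux]

definition spec_index :: "nat \<Rightarrow> nat" where
  "spec_index k = (if k < 5 then k else if k mod 4 = 1 then 5 else if k mod 4 = 2 then 6
     else if k mod 4 = 3 then 7 else 8)"

lemma spec_index_cases:
  fixes k :: nat
  obtains "k \<in> {0, 1, 2, 3, 4}" | "k \<ge> 5" "k mod 4 = 0" | "k \<ge> 5" "k mod 4 = 1"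
  | "k \<ge> 5" "k mod 4 = 2" | "k \<ge> 5" "k mod 4 = 3"
proof -
  have "k \<in> {0, 1, 2, 3, 4} \<or> k \<ge> 5" by auto
  moreover have "k mod 4 = 0 \<or> k mod 4 = 1 \<or> k mod 4 = 2 \<or> k mod 4 = 3" by presburger
  ultimately show thesis using that by metis
qed

lemma spec_index_step:
  "(spec_index k, if k mod 4 = 0 then 1 else 0, spec_index (Suc k)) \<in> set special_steps"
proof (cases k rule: spec_index_cases)
  case 1
  then show ?thesis by (auto simp: spec_index_def special_steps_def)
next
  case 2
  then have "Suc k mod 4 = 1" by presburger
  with 2 show ?thesis by (simp add: spec_index_def special_steps_def)
next
  case 3
  then have "Suc k mod 4 = 2" by presburger
  with 3 show ?thesis by (simp add: spec_index_def special_steps_def)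
next
  case 4
  then have "Suc k mod 4 = 3" by presburger
  with 4 show ?thesis by (simp add: spec_index_def special_steps_def)
next
  case 5
  then have "Suc k mod 4 = 0" by presburger
  with 5 show ?thesis by (simp add: spec_index_def special_steps_def)
qed

lemma exact_special_step:
  assumes "(j, d, j') \<in> set special_steps" "exact n (special j)" "child n d n'"
  shows "exact n' (special j')"
  using assms special_steps_ok covers_child supports_child
  unfolding special_steps_ok_iff exact_def by blast

text \<open>Both halves come from the digit 0, under which 0 is its own child: closure of
  \<open>special 0\<close> gives the cover, growth from the zero deviation the support.\<close>

lemma exact_zero: "exact 0 (special 0)"
proof -
  have "(0, 0, 0) \<in> set special_steps" by (simp add: special_steps_def)
  then have "upper_step 0 (special 0) (special 0)"
    using special_steps_ok unfolding special_steps_ok_iff by blast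
  then have "covers 0 (special 0)" using zero_in_special_zero by (rule covers_zero)
  moreover have "supports 0 [((0, 0, 0, 0), 0, 0)]"
    unfolding supports_def
  proof
    fix e :: elem assume "e \<in> set [((0, 0, 0, 0), 0, 0)]"
    then have "dominates (dev 0 0 0, letter 0, letter 0) e"
      by (simp add: dev_def zero_prod_def letter_zero dominates_def)
    then show "\<exists>e'\<in>realized 0. dominates e' e" using realizedI by (rule bexI)
  qed
  then have "supports 0 (special 0)"
    by (rule supports_iterates_hit[OF special_zero_hit[unfolded force_def]])
  ultimately show ?thesis by (simp add: exact_def)
qed

lemma exact_spec: "exact (spec k) (special (spec_index k))"
proof (induction k)
  case 0
  show ?case using exact_zero by (simp add: spec_index_def)
next
  case (Suc k)
  show ?case by (rule exact_special_step[OF spec_index_step Suc child_spec])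
qed

lemma child_eq: "child i d j \<Longrightarrow> pvec i = s \<Longrightarrow> pvec j = step (int d) s \<and> int j = len (step (int d) s)"
  using pvec_child len_pvec by metis

text \<open>The digit strings are 11, 110 and 1100. Values of \<open>img\<close> are obtained from
  Parikh vectors, whose total is the position, instead of by unfolding the word.\<close>

lemma child_small: "child 1 1 3" "child 3 0 6" "child 6 0 12" and letter_3: "letter 3 = 2"
proof -
  have 1: "pvec 1 = (1, 0, 0, 0)" "letter 1 = 1"
    using pvec_child[of 0 1 1] letter_child[of 0 1 1] letter_zero by (auto simp: child_def zero_prod_def)
  have c: "child 1 1 (img 1 + 1)" using 1 by (simp add: child_def)
  then have 3: "img 1 + 1 = 3" "pvec 3 = (2, 1, 0, 0)" using child_eq[OF c 1(1)] by auto
  show c3: "child 1 1 3" using c 3 by simp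
  then show "letter 3 = 2" using letter_child[OF c3] 1(2) by simp
  have c: "child 3 0 (img 3)" by (simp add: child_def)
  then have 6: "img 3 = 6" "pvec 6 = (3, 2, 1, 0)" using child_eq[OF c 3(2)] by auto
  show "child 3 0 6" using c 6 by simp
  have c: "child 6 0 (img 6)" by (simp add: child_def)
  then have "img 6 = 12" using child_eq[OF c 6(2)] by auto
  then show "child 6 0 12" using c by simp
qed

lemma letter_6_12: "letter 6 = 0" "letter 12 = 0"
  using letter_child child_small by fastforce+

lemma exact_small: "exact 3 (special 9)" "exact 6 (special 10)" "exact 12 (special 11)"
proof -
  have "exact 1 (special 1)" using exact_spec[of 1] by (simp add: spec_index_def)
  then show 3: "exact 3 (special 9)"
    by (rule exact_special_step[rotated, OF _ child_small(1)]) (simp add: special_steps_def)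
  show 6: "exact 6 (special 10)"
    by (rule exact_special_step[OF _ 3 child_small(2)]) (simp add: special_steps_def)
  show "exact 12 (special 11)"
    by (rule exact_special_step[OF _ 6 child_small(3)]) (simp add: special_steps_def)
qed

lemma complexity_special:
  assumes "exact n (special j)"
  shows "j \<in> {1..8} \<Longrightarrow> abelian_complexity fourbonacci_word n = 4"
    and "j \<in> {9..11} \<Longrightarrow> abelian_complexity fourbonacci_word n = 6"
proof -
  have eq: "abelian_complexity fourbonacci_word n = num_balanced (special j)"
    using exact_complexity[OF assms] by (simp add: num_balanced_def)
  have "j \<in> {1, 2, 3, 4, 5, 6, 7, 8}" if "j \<in> {1..8}" using that by auto
  then show "j \<in> {1..8} \<Longrightarrow> abelian_complexity fourbonacci_word n = 4"
    using special_counts_ok unfolding eq special_counts_ok_iff by auto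
  have "j \<in> {9, 10, 11}" if "j \<in> {9..11}" using that by auto
  then show "j \<in> {9..11} \<Longrightarrow> abelian_complexity fourbonacci_word n = 6"
    using special_counts_ok unfolding eq special_counts_ok_iff by auto
qed

lemma complexity_spec: "k \<ge> 1 \<Longrightarrow> abelian_complexity fourbonacci_word (spec k) = 4"
  using complexity_special(1)[OF exact_spec[of k]] by (auto simp: spec_index_def)

lemma complexity_small: "n \<in> {3, 6, 12} \<Longrightarrow> abelian_complexity fourbonacci_word n = 6"
  using complexity_special(2)[OF exact_small(1)] complexity_special(2)[OF exact_small(2)]
    complexity_special(2)[OF exact_small(3)] by auto

section \<open>Lower bound away from the exceptional numbers\<close>

definition supported :: "nat \<Rightarrow> bool" where
  "supported n \<longleftrightarrow>
     (\<exists>m t0 t1 k. (m, t0, t1, k) \<in> set support_rows \<and> m \<le> letter n \<and> supports n (members k))"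

lemma supported_child: "supported n \<Longrightarrow> child n d n' \<Longrightarrow> supported n'"
  unfolding supported_def
  using rows_ok_child[OF support_rows_ok, of supports] supports_child by blast

lemma supported_complexity: "supported n \<Longrightarrow> abelian_complexity fourbonacci_word n \<ge> 7"
  unfolding supported_def using rows_ok_count[OF support_rows_ok] supports_lower
  by (metis num_balanced_def order_trans)

lemma supported_exit:
  assumes "(j, d, m, g) \<in> set special_exits" "exact n (special j)" "child n d n'" "m \<le> letter n'"
  shows "supported n'"
proof -
  have "holds_at g support_rows (row_step_ok (lower_step d (special j)) m)"
    using special_exits_ok assms(1) unfolding special_exits_ok_iff by blast
  then obtain m' t0 t1 k where "(m', t0, t1, k) \<in> set support_rows" "m' \<le> m"
      "lower_step d (special j) (members k)" by (rule row_step_okE)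
  then show ?thesis
    unfolding supported_def using assms(2-4) supports_child unfolding exact_def by (meson order_trans)
qed

text \<open>Induction along the parent: a child of an exceptional number is exceptional or enters
  \<open>support_rows\<close>, and supported numbers have supported children.\<close>

lemma special_or_supported: "(\<exists>k. n = spec k) \<or> n \<in> {3, 6, 12} \<or> supported n"
proof (induction n rule: less_induct)
  case (less n)
  show ?case
  proof (cases "n = 0")
    case True
    then show ?thesis by (metis spec.simps(1))
  next
    case False
    obtain i d where ch: "child i d n" using child_exists by blast
    then have less_n: "i < n" using False child_less by simp
    have letter_n: "letter n = (if d = 0 then 0 else Suc (letter i))" by (rule letter_child[OF ch])
    have unique: "n = n'" if "child i d n'" for n' using ch that by (simp add: child_def)
    consider (spec) k where "i = spec k" | (small) "i \<in> {3, 6, 12}" | (supported) "supported i"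
      using less.IH[OF less_n] by blast
    then show ?thesis
    proof cases
      case (spec k)
      show ?thesis
      proof (cases "d = (if k mod 4 = 0 then 1 else 0)")
        case True
        then have "n = spec (Suc k)" using unique child_spec[of k] spec by metis
        then show ?thesis by blast
      next
        case False
        \<comment> \<open>The digit departs from the pattern. After 0 the digit 0 gives 0 again,
          after 1 the digit 1 gives 3, and from \<open>k = 2\<close> on the wrong digit is listed in
          \<open>special_exits\<close>.\<close>
        then have d: "d = (if k mod 4 = 0 then 0 else 1)" using child_digit[OF ch] by (auto split: if_splits)
        consider "k = 0" | "k = 1" | "k \<ge> 2" by linarith
        then show ?thesis
        proof cases
          case 1
          then have "n = 0" using d ch spec by (simp add: child_def)
          then show ?thesis by (metis spec.simps(1))
        next
          case 2
          then have "n = 3" using d unique child_small(1) spec by simp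
          then show ?thesis by simp
        next
          case 3
          have "\<exists>m g. (spec_index k, d, m, g) \<in> set special_exits \<and> m \<le> letter n"
          proof (cases k rule: spec_index_cases)
            case 1
            with 3 have "k = 2 \<or> k = 3 \<or> k = 4" by auto
            then show ?thesis
              using d letter_n by (auto simp: spec_index_def special_exits_def)
          qed (use d letter_n spec letter_spec[of k] in
              \<open>auto simp: spec_index_def special_exits_def\<close>)
          then show ?thesis using supported_exit exact_spec[of k] ch spec by metis
        qed
      qed
    next
      case small
      \<comment> \<open>The digit 0 leads from 3 to 6 and from 6 to 12; all other children are
        exits.\<close>
      show ?thesis
      proof (cases "d = 0 \<and> i \<noteq> 12")
        case True
        then have "n = 6 \<or> n = 12" using small unique child_small by auto
        then show ?thesis by auto
      next
        case False
        then have d: "d = 1 \<or> i = 12 \<and> d = 0" using child_digit[OF ch] by auto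
        have "\<exists>j m g. (j, d, m, g) \<in> set special_exits \<and> exact i (special j) \<and> m \<le> letter n"
          using small
        proof (elim insertE)
          assume "i = 3"
          then show ?thesis using d letter_n letter_3 exact_small(1)
            by - (rule exI[of _ 9], auto simp: special_exits_def)
        next
          assume "i = 6"
          then show ?thesis using d letter_n letter_6_12 exact_small(2)
            by - (rule exI[of _ 10], auto simp: special_exits_def)
        next
          assume "i = 12"
          then show ?thesis using d letter_n letter_6_12 exact_small(3)
            by - (rule exI[of _ 11], auto simp: special_exits_def)
        qed simp
        then show ?thesis using supported_exit ch by blast
      qed
    next
      case supported
      then show ?thesis using supported_child ch by blast
    qed
  qed
qed

section \<open>Upper bound for all numbers\<close>

lemma complexity_le_16: "abelian_complexity fourbonacci_word n \<le> 16"
proof -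
  have "\<exists>m t0 t1 k. (m, t0, t1, k) \<in> set cover_rows \<and> m \<le> letter n \<and> covers n (members k)"
  proof (induction n rule: less_induct)
    case (less n)
    show ?case
    proof (cases "n = 0")
      case True
      \<comment> \<open>\<open>cover_start\<close> leads from the exact state of 0 under the digit 0
        into the table; as 0 is its own child, the row reached covers 0.\<close>
      obtain m t0 t1 k where "(m, t0, t1, k) \<in> set cover_rows" "m \<le> 0"
          "upper_step 0 (special 0) (members k)"
        using cover_start unfolding force_def by (rule row_step_okE)
      then show ?thesis
        using True exact_zero covers_child[OF _ child_zero] unfolding exact_def by fastforce
    next
      case False
      obtain i d where ch: "child i d n" using child_exists by blast
      then have "i < n" using False child_less by simp
      from less[OF this] show ?thesis
        using rows_ok_child[OF cover_rows_ok, of covers] covers_child ch by blast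
    qed
  qed
  then show ?thesis
    using rows_ok_count[OF cover_rows_ok] covers_upper by (metis num_balanced_def order_trans)
qed

section \<open>Infinitely many numbers for each complexity from 7 to 16\<close>

lemma img_strict_mono: "strict_mono img"
  by (simp add: strict_mono_Suc_iff img_Suc)

lemma append_digits_strict_mono: "m < n \<Longrightarrow> append_digits m ds < append_digits n ds"
  by (induction ds arbitrary: m n) (simp_all add: strict_monoD[OF img_strict_mono])

lemma append_digits_ge: "n \<ge> 1 \<Longrightarrow> n \<le> append_digits n ds"
proof (induction ds arbitrary: n)
  case (Cons d ds)
  then have "n < img n" using less_img by simp
  with Cons.IH[of "img n + d"] show ?case by simp
qed simp

lemma spec_less_Suc: "spec k < spec (Suc k)"
proof (induction k)
  case (Suc k)
  then have "spec (Suc k) \<ge> 1" by linarith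
  then show ?case using less_img[of "spec (Suc k)"] unfolding spec.simps(2)[of "Suc k"] by linarith
qed simp

lemma spec_strict_mono: "strict_mono spec"
  unfolding strict_mono_Suc_iff using spec_less_Suc by blast

lemma infinite_complexity:
  assumes "c \<in> {7..16}"
  shows "infinite {n. n \<ge> 1 \<and> abelian_complexity fourbonacci_word n = c}"
proof -
  have "\<exists>ds. (c, ds) \<in> set complexity_words"
  proof -
    have "c = 7 \<or> c = 8 \<or> c = 9 \<or> c = 10 \<or> c = 11 \<or> c = 12 \<or> c = 13 \<or> c = 14 \<or> c = 15 \<or> c = 16"
      using assms unfolding atLeastAtMost_iff by presburger
    then show ?thesis by (elim disjE) (simp_all add: complexity_words_def)
  qed
  then obtain ds where "(c, ds) \<in> set complexity_words" ..
  then have run: "run_count 0 ds (special 6) c"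
    using complexity_words_ok unfolding force_def runs_ok_iff by blast
  have spec_mono: "spec i < spec j" if "i < j" for i j
    using spec_strict_mono that by (rule strict_monoD)
  \<comment> \<open>The indices \<open>4 * j + 6\<close> are at least 5 and congruent to 2 modulo 4,
    so \<open>spec\<close> is there in state 6 with letter 0, where the run along \<open>ds\<close>
    starts.\<close>
  define f where "f j = append_digits (spec (4 * j + 6)) ds" for j
  have mod: "(4 * j + 6) mod 4 = 2" for j :: nat by presburger
  have "abelian_complexity fourbonacci_word (f j) = c" for j
    unfolding f_def
    by (rule run_count_complexity[OF run]) (use exact_spec[of "4 * j + 6"] letter_spec[of "4 * j + 6"] mod[of j]
        in \<open>simp_all add: spec_index_def del: spec.simps\<close>)
  moreover have "f j \<ge> 1" for j
    using append_digits_ge[of "spec (4 * j + 6)" ds] spec_mono[of 0 "4 * j + 6"]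
    by (simp add: f_def del: spec.simps(2))
  moreover have "strict_mono f"
    unfolding f_def by (intro strict_monoI append_digits_strict_mono spec_mono) simp
  then have "infinite (range f)"
    by (simp add: finite_image_iff strict_mono_imp_inj_on)
  ultimately show ?thesis by (elim infinite_super[rotated]) auto
qed

subsection \<open>The representations of the special numbers\<close>

abbreviation pattern :: "nat stream" where
  "pattern \<equiv> cycle [1, 0, 0, 0]"

lemma stake_pattern: "stake (k + 4) pattern = [1, 0, 0, 0] @ stake k pattern"
proof -
  have "stake (k + 4) ([1, 0, 0, 0] @- pattern) = [1, 0, 0, 0] @ stake k pattern"
    unfolding stake_shift by simp
  moreover have "[1, 0, 0, 0] @- pattern = pattern"
    by (rule cycle_decomp[symmetric]) simp
  ultimately show ?thesis by metis
qed

text \<open>The Parikh vector of the \<open>k\<close>-fold image of the letter 0: it starts at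
  \<open>(1, 0, 0, 0)\<close> and advances by \<open>step 0\<close>.\<close>

fun tetravec :: "nat \<Rightarrow> vec" where
  "tetravec k = (int (tetranacci (k + 3)), int (tetranacci (k + 2)), int (tetranacci (k + 1)), int (tetranacci k))"

lemma tetranacci_rec:
  "tetranacci (k + 4) = tetranacci (k + 3) + tetranacci (k + 2) + tetranacci (k + 1) + tetranacci k"
  by (simp add: eval_nat_numeral)

lemma step_tetravec: "step 0 (tetravec k) = tetravec (Suc k)"
  using tetranacci_rec[of k] by (simp add: eval_nat_numeral)

lemma pvec_spec_Suc: "pvec (spec (Suc k)) = step (if k mod 4 = 0 then 1 else 0) (pvec (spec k))"
  using pvec_child[OF child_spec[of k]] by (simp del: spec.simps)

lemma pvec_spec_small:
  "pvec (spec 1) = (1, 0, 0, 0)" "pvec (spec 2) = (1, 1, 0, 0)" "pvec (spec 3) = (2, 1, 1, 0)"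
  "pvec (spec 4) = (4, 2, 1, 1)"
proof -
  have 1: "pvec (spec (Suc 0)) = (1, 0, 0, 0)"
    unfolding pvec_spec_Suc by (simp add: zero_prod_def)
  have 2: "pvec (spec (Suc (Suc 0))) = (1, 1, 0, 0)"
    unfolding pvec_spec_Suc[of "Suc 0"] 1 by simp
  have 3: "pvec (spec (Suc (Suc (Suc 0)))) = (2, 1, 1, 0)"
    unfolding pvec_spec_Suc[of "Suc (Suc 0)"] 2 by simp
  have 4: "pvec (spec (Suc (Suc (Suc (Suc 0))))) = (4, 2, 1, 1)"
    unfolding pvec_spec_Suc[of "Suc (Suc (Suc 0))"] 3 by simp
  show "pvec (spec 1) = (1, 0, 0, 0)" "pvec (spec 2) = (1, 1, 0, 0)" "pvec (spec 3) = (2, 1, 1, 0)"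
    "pvec (spec 4) = (4, 2, 1, 1)"
    using 1 2 3 4 by (simp_all only: eval_nat_numeral One_nat_def BitM.simps numeral_One)
qed

lemma spec_small: "spec 1 = 1" "spec 2 = 2" "spec 3 = 4"
proof -
  have "pvec (spec k) = s \<Longrightarrow> int (spec k) = len s" for k s
    using len_pvec by metis
  from this[OF pvec_spec_small(1)] this[OF pvec_spec_small(2)] this[OF pvec_spec_small(3)]
  show "spec 1 = 1" "spec 2 = 2" "spec 3 = 4" by (simp_all del: spec.simps)
qed

lemma tetranacci_small:
  "tetranacci 3 = 1" "tetranacci 4 = 1" "tetranacci 5 = 2" "tetranacci 6 = 4" "tetranacci 7 = 8"
  by (simp_all add: eval_nat_numeral)

text \<open>Putting 1000 in front of the digits adds the vector of the leading one. The pattern has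
  period 4, so both sides receive the same digits, and linearity of \<open>step\<close> carries the
  sum along.\<close>

lemma pvec_spec_add_4: "pvec (spec (k + 4)) = tetravec (k + 3) + pvec (spec k)"
proof (induction k)
  case 0
  show ?case by (simp add: pvec_spec_small tetranacci_small del: spec.simps(2))
next
  case (Suc k)
  have "pvec (spec (Suc k + 4)) = step (0 + (if k mod 4 = 0 then 1 else 0)) (tetravec (k + 3) + pvec (spec k))"
    using pvec_spec_Suc[of "k + 4"] Suc by (simp del: spec.simps tetravec.simps)
  also have "\<dots> = tetravec (Suc k + 3) + pvec (spec (Suc k))"
    unfolding step_add pvec_spec_Suc step_tetravec by simp
  finally show ?case .
qed

lemma spec_add_4: "spec (k + 4) = tetranacci (k + 7) + spec k"
proof -
  have "int (spec (k + 4)) = len (tetravec (k + 3)) + int (spec k)"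
    using arg_cong[OF pvec_spec_add_4[of k], of len] by (simp del: spec.simps tetravec.simps)
  moreover have "len (tetravec (k + 3)) = int (tetranacci (k + 7))"
    using tetranacci_rec[of "k + 3"] by (simp add: eval_nat_numeral)
  ultimately show ?thesis by linarith
qed

lemma four_induct [case_names 0 1 2 3 add]:
  assumes "P 0" "P 1" "P 2" "P 3" "\<And>k. P k \<Longrightarrow> P (k + 4)"
  shows "P (k :: nat)"
proof (induction k rule: less_induct)
  case (less k)
  show ?case
  proof (cases "k < 4")
    case True
    then have "k = 0 \<or> k = 1 \<or> k = 2 \<or> k = 3" by auto
    then show ?thesis using assms(1-4) by blast
  next
    case False
    then have "P (k - 4 + 4)" using less by (intro assms(5)) auto
    with False show ?thesis by simp
  qed
qed

text \<open>Together with \<open>tetranacci_le_spec\<close> this pins down that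
  \<open>spec k\<close> has exactly \<open>k\<close> digits.\<close>

lemma spec_less_tetranacci: "spec k < tetranacci (k + 4)"
proof (induction k rule: four_induct)
  case (add k)
  have "tetranacci (k + 7) + tetranacci (k + 4) \<le> tetranacci (k + 8)"
    using tetranacci_rec[of "k + 4"] by (simp add: eval_nat_numeral)
  with add show ?case unfolding spec_add_4 by (simp add: add.assoc)
qed (simp_all add: spec_small spec_small(1)[unfolded One_nat_def] tetranacci_small del: spec.simps(2))

lemma tetranacci_le_spec: "tetranacci (k + 4) \<le> spec (Suc k)"
proof (induction k rule: four_induct)
  case (add k)
  show ?case using spec_add_4[of "Suc k"] by (simp add: eval_nat_numeral del: spec.simps)
next
  case 3
  show ?case using spec_add_4[of 0] by (simp add: tetranacci_small del: spec.simps(2))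
qed (simp_all add: tetranacci_small spec_small(2,3) spec_small(1)[unfolded One_nat_def]
      numeral_2_eq_2[symmetric] numeral_3_eq_3[symmetric] del: spec.simps(2))

lemma greedy_digits_spec: "greedy_digits k (spec k) = stake k pattern"
proof (induction k rule: four_induct)
  case (add k)
  \<comment> \<open>Once the leading one is removed, the remainder is smaller than the next three
    weights, which yields the three zeros.\<close>
  have "\<not> tetranacci (k + 4) \<le> spec k" "\<not> tetranacci (Suc k + 4) \<le> spec k"
      "\<not> tetranacci (Suc (Suc k) + 4) \<le> spec k"
    using spec_less_tetranacci[of k] tetranacci_growth[of k] tetranacci_growth[of "k + 1"]
    by (simp_all add: add.commute[of k] del: tetranacci.simps)
  then have "greedy_digits (Suc (Suc (Suc (Suc k)))) (tetranacci (Suc (Suc (Suc k)) + 4) + spec k) =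
      [1, 0, 0, 0] @ greedy_digits k (spec k)"
    by (simp only: greedy_digits.simps le_add1 add_diff_cancel_left' if_True if_False append.simps)
  moreover have "k + 4 = Suc (Suc (Suc (Suc k)))" "k + 7 = Suc (Suc (Suc k)) + 4" by simp_all
  ultimately show ?case unfolding stake_pattern spec_add_4 using add by metis
next
  case 0
  show ?case by simp
next
  case 1
  have "greedy_digits 1 1 = stake 1 pattern" by (simp add: eval_nat_numeral)
  then show ?case by (simp only: spec_small)
next
  case 2
  have "greedy_digits 2 2 = stake 2 pattern" by (simp add: eval_nat_numeral)
  then show ?case by (simp only: spec_small)
next
  case 3
  have "greedy_digits 3 4 = stake 3 pattern" by (simp add: eval_nat_numeral)
  then show ?case by (simp only: spec_small)
qed

lemma fourbonacci_rep_spec: "fourbonacci_rep (spec k) = stake k pattern"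
proof -
  have "(LEAST j. spec k < tetranacci (j + 4)) = k"
  proof (rule Least_equality)
    show "spec k < tetranacci (k + 4)" by (rule spec_less_tetranacci)
  next
    fix j assume j: "spec k < tetranacci (j + 4)"
    show "k \<le> j"
    proof (rule ccontr)
      assume "\<not> k \<le> j"
      then have "Suc j \<le> k" by simp
      then have "spec (Suc j) \<le> spec k"
        using strict_mono_less_eq[OF spec_strict_mono] by blast
      with tetranacci_le_spec[of j] j show False by linarith
    qed
  qed
  then show ?thesis by (simp only: fourbonacci_rep_def greedy_digits_spec)
qed

text \<open>\<open>rep_value\<close> recovers a number from its representation, so equal digit
  strings force equal numbers.\<close>

lemma fourbonacci_rep_pattern_iff: "(\<exists>k. fourbonacci_rep n = stake k pattern) \<longleftrightarrow> (\<exists>k. n = spec k)"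
  by (metis fourbonacci_rep_spec rep_value_fourbonacci_rep)

theorem theorem14:
  shows "abelian_complexity fourbonacci_word ` {n. n \<ge> 1} = {4} \<union> {6..16} \<and>
    (\<forall>n\<ge>1. abelian_complexity fourbonacci_word n = 4 \<longleftrightarrow>
       (\<exists>k. fourbonacci_rep n = stake k (cycle [1, 0, 0, 0]))) \<and>
    (\<forall>n\<ge>1. abelian_complexity fourbonacci_word n = 6 \<longleftrightarrow> n \<in> {3, 6, 12}) \<and>
    (\<forall>c\<in>{7..16}. infinite {n. n \<ge> 1 \<and> abelian_complexity fourbonacci_word n = c})"
proof -
  let ?\<rho> = "abelian_complexity fourbonacci_word"
  have spec: "?\<rho> n = 4" if "n = spec k" "n \<ge> 1" for n k
  proof -
    \<comment> \<open>The index 0 belongs to the number 0, which \<open>n \<ge> 1\<close>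
      excludes.\<close>
    have "k \<noteq> 0" using that by (auto intro: ccontr)
    then show ?thesis using complexity_spec[of k] that(1) by simp
  qed
  \<comment> \<open>The three alternatives carry disjoint values of the complexity, so the value
    determines the class of \<open>n\<close>; both equivalences rest on this.\<close>
  have cases: "(\<exists>k. n = spec k) \<and> ?\<rho> n = 4 \<or> n \<in> {3, 6, 12} \<and> ?\<rho> n = 6 \<or> ?\<rho> n \<in> {7..16}" if "n \<ge> 1" for n
    using special_or_supported[of n] spec[OF _ that] complexity_small[of n]
      supported_complexity[of n] complexity_le_16[of n] by auto
  have four: "?\<rho> n = 4 \<longleftrightarrow> (\<exists>k. n = spec k)" if "n \<ge> 1" for n
    using cases[OF that] spec[OF _ that] by fastforce
  have six: "?\<rho> n = 6 \<longleftrightarrow> n \<in> {3, 6, 12}" if "n \<ge> 1" for n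
    using cases[OF that] complexity_small[of n] by fastforce
  have "?\<rho> ` {n. n \<ge> 1} \<subseteq> {4} \<union> {6..16}"
    using cases by fastforce
  moreover have "v \<in> ?\<rho> ` {n. n \<ge> 1}" if v: "v \<in> {4} \<union> {6..16}" for v
  proof -
    consider "v = 4" | "v = 6" | "v \<in> {7..16}" using v by force
    then show ?thesis
    proof cases
      case 1
      then show ?thesis using complexity_spec[of 1] by (intro image_eqI[of _ _ 1]) simp_all
    next
      case 2
      then show ?thesis using complexity_small[of 3] by (intro image_eqI[of _ _ 3]) simp_all
    next
      case 3
      then show ?thesis using infinite_imp_nonempty[OF infinite_complexity[OF 3]] by blast
    qed
  qed
  ultimately have "?\<rho> ` {n. n \<ge> 1} = {4} \<union> {6..16}"
    by (rule equalityI[OF _ subsetI])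
  moreover have "?\<rho> n = 4 \<longleftrightarrow> (\<exists>k. fourbonacci_rep n = stake k (cycle [1, 0, 0, 0]))" if "n \<ge> 1" for n
    unfolding four[OF that] by (rule fourbonacci_rep_pattern_iff[symmetric])
  ultimately show ?thesis
    using six infinite_complexity by (intro conjI allI impI ballI)
qed

end
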